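(* Let $m\geq 1$ be an integer, $\varepsilon\in\{-1,+1\}$, $W=\mathbb{Z}_2\times D_{2m}$ acting on $\mathbb{R}^3$ with root system $R$, and $\kappa:R\to\mathbb{C}$ a $W$-invariant function. In $\mathcal{A}_\kappa\otimes Cl^{\varepsilon}(3)$, with the one-, two- and three-index symmetries $O_j$, $O_{ij}$, $O_{123}$ as defined in the context, the three-index symmetry squares to $$O_{123}^2=-\frac{\varepsilon}{4}+O_1^2+O_2^2+O_3^2+\varepsilon\bigl(O_{12}^2+O_{31}^2+O_{23}^2\bigr).$$
   Context: Notation: $[a,b]=ab-ba$, $\{a,b\}=ab+ba$. $\mathbb{R}^3$ has canonical basis $\xi_1,\xi_2,\xi_3$ and canonical bilinear form $\langle-,-\rangle$. Put $\alpha_0=(0,0,1)$ and $\alpha_j=(\sin(j\pi/m),-\cos(j\pi/m),0)$ for $1\le j\le 2m$. The root system is $R=\{\alpha_0,-\alpha_0\}\cup\{\alpha_j: 1\le j\le 2m\}$, with positive roots $R_+=\{\alpha_0,\alpha_1,\dots,\alpha_m\}$. For $\alpha\in R$, $\sigma_\alpha(x)=x-2\frac{\langle x,\alpha\rangle}{\langle\alpha,\alpha\rangle}\alpha$, and $W\cong\mathbb{Z}_2\times D_{2m}$ ($D_{2m}$ the dihedral group of order $2m$) is the group generated by these reflections, acting on functions on $\mathbb{R}^3$ by $(wf)(x)=f(w^{-1}x)$. The function $\kappa:R\to\mathbb{C}$ is constant on $W$-orbits. Dunkl operators, acting on polynomials $\mathbb{C}[x_1,x_2,x_3]$: $$\mathcal{D}_jf(x)=\partial_{x_j}f(x)+\sum_{\alpha\in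 R_+}\kappa(\alpha)\frac{f(x)-f(\sigma_\alpha(x))}{\langle x,\alpha\rangle}\langle\alpha,\xi_j\rangle .$$ $\mathcal{A}_\kappa$ is the associative algebra of operators on $\mathbb{C}[x_1,x_2,x_3]$ generated by the $\mathcal{D}_j$, the multiplication operators $x_j$, and $\mathbb{C}[W]$. $Cl^{\varepsilon}(3)$ is the (complex) Clifford algebra generated by $e_1,e_2,e_3$ with $\{e_j,e_k\}=2\varepsilon\delta_{jk}$. All elements below live in $\mathcal{A}_\kappa\otimes Cl^{\varepsilon}(3)$ (ordinary tensor product; elements of the two factors commute; $\otimes$ is often omitted). For $\alpha\in R$ let $\widetilde{\sigma}_\alpha=\sigma_\alpha\otimes\sum_{j=1}^3\langle\alpha,\xi_j\rangle e_j$. One-index symmetries: $$O_j=\varepsilon\sum_{k=0}^m\kappa(\alpha_k)\langle\alpha_k,\xi_j\rangle\widetilde{\sigma}_{\alpha_k}=\frac{\varepsilon}{2}\Bigl(\sum_{k=1}^3e_k[\mathcal{D}_k,x_j]-e_j\Bigr).$$ With $L_{ij}=x_i\mathcal{D}_j-x_j\mathcal{D}_i$, two-index symmetries: $O_{ij}=L_{ij}+\frac{\varepsilon}{2}e_ie_j+O_ie_j-O_je_i$ (equivalently $L_{ij}+\frac{\varepsilon}{2}e_ie_j+e_iO_j-e_jO_i$). Three-index symmetry: $$O_{123}=-\frac{\varepsilon}{2}e_1e_2e_3-O_1e_2e_3-O_2e_3e_1-O_3e_1e_2+O_{12}e_3+O_{31}e_2+O_{23}e_1,$$ equivalently $$O_{123}=-\frac{\varepsilon}{2}e_1e_2e_3-e_2e_3O_1-e_3e_1O_2-e_1e_2O_3+e_3O_{12}+e_2O_{31}+e_1O_{23}.$$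 *)

theory Defs
  imports "HOL-Analysis.Analysis" "HOL-Algebra.Bij" "HOL-Algebra.Generated_Groups"
begin

section \<open>Complex algebras\<close>

class scaleC =
  fixes scaleC :: "complex \<Rightarrow> 'a \<Rightarrow> 'a"  (infixr "*\<^sub>C" 75)

class complex_vector = scaleC + ab_group_add +
  assumes scaleC_add_right: "c *\<^sub>C (x + y) = c *\<^sub>C x + c *\<^sub>C y"
    and scaleC_add_left: "(c + d) *\<^sub>C x = c *\<^sub>C x + d *\<^sub>C x"
    and scaleC_scaleC: "c *\<^sub>C d *\<^sub>C x = (c * d) *\<^sub>C x"
    and scaleC_one: "1 *\<^sub>C x = x"

class complex_algebra_1 = complex_vector + ring_1 +
  assumes mult_scaleC_left: "(c *\<^sub>C x) * y = c *\<^sub>C (x * y)"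
    and mult_scaleC_right: "x * (c *\<^sub>C y) = c *\<^sub>C (x * y)"

lemma module_scaleC: "module (scaleC :: complex \<Rightarrow> 'a \<Rightarrow> 'a::complex_vector)"
  by (simp add: module_def scaleC_add_right scaleC_add_left scaleC_scaleC scaleC_one)

lemma scaleC_zero_left [simp]: "0 *\<^sub>C (x::'a::complex_vector) = 0"
  and scaleC_zero_right [simp]: "c *\<^sub>C (0::'a::complex_vector) = 0"
  by (rule module.scale_zero_left[OF module_scaleC] module.scale_zero_right[OF module_scaleC])+

lemma scaleC_minus_right: "c *\<^sub>C (- (x::'a::complex_vector)) = - (c *\<^sub>C x)"
  by (rule module.scale_minus_right[OF module_scaleC])

lemma scaleC_diff_right: "c *\<^sub>C ((x::'a::complex_vector) - y) = c *\<^sub>C x - c *\<^sub>C y"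
  by (rule module.scale_right_diff_distrib[OF module_scaleC])

lemma scaleC_sum_right: "c *\<^sub>C (\<Sum>i\<in>I. f i) = (\<Sum>i\<in>I. c *\<^sub>C (f i :: 'a::complex_vector))"
  by (rule module.scale_sum_right[OF module_scaleC])


section \<open>Polynomials on three-dimensional space\<close>

text \<open>
  Since \<open>\<real>\<close> is infinite, \<open>\<complex>[x\<^sub>1, x\<^sub>2, x\<^sub>3]\<close> is the algebra of complex-valued polynomial functions
  on \<open>\<real>\<^sup>3\<close>.
\<close>

lemma polynomial_function_complex_iff:
  "polynomial_function (f :: 'a::real_normed_vector \<Rightarrow> complex) \<longleftrightarrow>
     real_polynomial_function (\<lambda>x. Re (f x)) \<and> real_polynomial_function (\<lambda>x. Im (f x))"
proof
  assume "polynomial_function f"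
  then show "real_polynomial_function (\<lambda>x. Re (f x)) \<and> real_polynomial_function (\<lambda>x. Im (f x))"
    using bounded_linear_Re bounded_linear_Im by (auto simp: polynomial_function_def o_def)
next
  assume r: "real_polynomial_function (\<lambda>x. Re (f x)) \<and> real_polynomial_function (\<lambda>x. Im (f x))"
  have "polynomial_function (\<lambda>x. Re (f x) *\<^sub>R (1::complex) + Im (f x) *\<^sub>R \<i>)"
    using r by (intro polynomial_function_add polynomial_function_mult)
       (auto simp: real_polynomial_function_eq)
  moreover have "(\<lambda>x. Re (f x) *\<^sub>R (1::complex) + Im (f x) *\<^sub>R \<i>) = f"
    by (auto simp: complex_eq_iff)
  ultimately show "polynomial_function f" by simp
qed

lemma polynomial_function_times:
  fixes f g :: "'a::real_normed_vector \<Rightarrow> complex"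
  assumes "polynomial_function f" "polynomial_function g"
  shows "polynomial_function (\<lambda>x. f x * g x)"
  using assms unfolding polynomial_function_complex_iff
  by (auto intro!: real_polynomial_function_diff real_polynomial_function.intros(3,4))

typedef poly3 = "{f :: real^3 \<Rightarrow> complex. polynomial_function f}"
  morphisms peval Abs_poly3
  by (rule exI[of _ "\<lambda>_. 0"]) simp

setup_lifting type_definition_poly3

lemma poly3_eqI: "(\<And>x. peval f x = peval g x) \<Longrightarrow> f = g"
  by (metis ext peval_inject)

instantiation poly3 :: comm_ring_1
begin
lift_definition zero_poly3 :: poly3 is "\<lambda>_. 0" by simp
lift_definition one_poly3 :: poly3 is "\<lambda>_. 1" by simp
lift_definition plus_poly3 :: "poly3 \<Rightarrow> poly3 \<Rightarrow> poly3" is "\<lambda>f g x. f x + g x"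
  by (rule polynomial_function_add)
lift_definition minus_poly3 :: "poly3 \<Rightarrow> poly3 \<Rightarrow> poly3" is "\<lambda>f g x. f x - g x"
  by (rule polynomial_function_diff)
lift_definition uminus_poly3 :: "poly3 \<Rightarrow> poly3" is "\<lambda>f x. - f x"
  by (rule polynomial_function_minus)
lift_definition times_poly3 :: "poly3 \<Rightarrow> poly3 \<Rightarrow> poly3" is "\<lambda>f g x. f x * g x"
  by (rule polynomial_function_times)
instance
  by standard (transfer; auto simp: algebra_simps dest: fun_cong)+
end

instantiation poly3 :: complex_algebra_1
begin
lift_definition scaleC_poly3 :: "complex \<Rightarrow> poly3 \<Rightarrow> poly3" is "\<lambda>c f x. c * f x"
  by (intro polynomial_function_times) auto
instance
  by standard (transfer; auto simp: algebra_simps)+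
end

lemma peval_simps [simp]:
  "peval 0 x = 0" "peval 1 x = 1" "peval (f + g) x = peval f x + peval g x"
  "peval (f - g) x = peval f x - peval g x" "peval (- f) x = - peval f x"
  "peval (f * g) x = peval f x * peval g x" "peval (c *\<^sub>C f) x = c * peval f x"
  by (transfer; simp)+

lift_definition linear_form :: "real^3 \<Rightarrow> poly3" is "\<lambda>\<alpha> x. complex_of_real (x \<bullet> \<alpha>)"
  by (intro polynomial_function_bounded_linear bounded_linear_compose[OF bounded_linear_of_real]
      bounded_linear_inner_left)

lift_definition coord :: "3 \<Rightarrow> poly3" is "\<lambda>j x. complex_of_real (x $ j)"
  by (intro polynomial_function_bounded_linear bounded_linear_compose[OF bounded_linear_of_real]
      bounded_linear_vec_nth)

lemma real_polynomial_function_has_derivative: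
  fixes f :: "'a::real_normed_vector \<Rightarrow> real"
  assumes "real_polynomial_function f"
  shows "\<exists>f'. (\<forall>x. (f has_derivative f' x) (at x)) \<and>
           (\<forall>v. real_polynomial_function (\<lambda>x. f' x v))"
  using assms
proof induction
  case (linear f)
  then show ?case
    by (intro exI[of _ "\<lambda>_. f"]) (auto simp: bounded_linear_imp_has_derivative)
next
  case (const c)
  show ?case by (intro exI[of _ "\<lambda>_ _. 0"]) auto
next
  case (add f g)
  then obtain f' g' where "\<forall>x. (f has_derivative f' x) (at x)" "\<forall>x. (g has_derivative g' x) (at x)"
    "\<forall>v. real_polynomial_function (\<lambda>x. f' x v)" "\<forall>v. real_polynomial_function (\<lambda>x. g' x v)"
    by blast
  then show ?case
    by (intro exI[of _ "\<lambda>x v. f' x v + g' x v"]) (auto intro!: has_derivative_add)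
next
  case (mult f g)
  then obtain f' g' where "\<forall>x. (f has_derivative f' x) (at x)" "\<forall>x. (g has_derivative g' x) (at x)"
    "\<forall>v. real_polynomial_function (\<lambda>x. f' x v)" "\<forall>v. real_polynomial_function (\<lambda>x. g' x v)"
    by blast
  with mult.hyps show ?case
    by (intro exI[of _ "\<lambda>x v. f x * g' x v + f' x v * g x"])
       (auto intro!: has_derivative_mult real_polynomial_function.intros(3,4))
qed

lemma polynomial_function_has_derivative:
  fixes f :: "'a::real_normed_vector \<Rightarrow> complex"
  assumes "polynomial_function f"
  shows "\<exists>f'. (\<forall>x. (f has_derivative f' x) (at x)) \<and> (\<forall>v. polynomial_function (\<lambda>x. f' x v))"
proof -
  have pf: "real_polynomial_function (\<lambda>x. Re (f x))" "real_polynomial_function (\<lambda>x. Im (f x))"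
    using assms by (auto simp: polynomial_function_complex_iff)
  obtain r where r: "\<forall>x. ((\<lambda>x. Re (f x)) has_derivative r x) (at x)"
      "\<forall>v. real_polynomial_function (\<lambda>x. r x v)"
    using real_polynomial_function_has_derivative[OF pf(1)] by (elim exE conjE)
  obtain i where i: "\<forall>x. ((\<lambda>x. Im (f x)) has_derivative i x) (at x)"
      "\<forall>v. real_polynomial_function (\<lambda>x. i x v)"
    using real_polynomial_function_has_derivative[OF pf(2)] by (elim exE conjE)
  have "((\<lambda>x. complex_of_real (Re (f x)) + \<i> * complex_of_real (Im (f x))) has_derivative
      (\<lambda>v. complex_of_real (r x v) + \<i> * complex_of_real (i x v))) (at x)" for x
    by (rule has_derivative_add[OF has_derivative_of_real[OF r(1)[rule_format]]
          has_derivative_mult_right[OF has_derivative_of_real[OF i(1)[rule_format]]]])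
  moreover have "(\<lambda>x. complex_of_real (Re (f x)) + \<i> * complex_of_real (Im (f x))) = f"
    by (simp add: fun_eq_iff complex_eq_iff)
  ultimately have f': "(f has_derivative (\<lambda>v. complex_of_real (r x v) + \<i> * complex_of_real (i x v))) (at x)"
    for x by simp
  show ?thesis
  proof (intro exI conjI allI)
    show "(f has_derivative (\<lambda>v. complex_of_real (r x v) + \<i> * complex_of_real (i x v))) (at x)" for x
      by (rule f')
    show "polynomial_function (\<lambda>x. complex_of_real (r x v) + \<i> * complex_of_real (i x v))" for v
      unfolding polynomial_function_complex_iff using r(2) i(2) by simp
  qed
qed

lemma peval_differentiable: "peval f differentiable (at x)"
  using polynomial_function_has_derivative[of "peval f"] peval[of f]
  by (auto simp: differentiable_def)

lift_definition partial :: "3 \<Rightarrow> poly3 \<Rightarrow> poly3" is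
  "\<lambda>j f x. frechet_derivative f (at x) (axis j 1)"
proof -
  fix j :: 3 and f :: "real^3 \<Rightarrow> complex"
  assume "polynomial_function f"
  then obtain f' where f': "\<forall>x. (f has_derivative f' x) (at x)"
    "\<forall>v. polynomial_function (\<lambda>x. f' x v)"
    using polynomial_function_has_derivative by blast
  then have "frechet_derivative f (at x) = f' x" for x
    using frechet_derivative_at by metis
  with f' show "polynomial_function (\<lambda>x. frechet_derivative f (at x) (axis j 1))" by simp
qed

lemma partial_add: "partial j (f + g) = partial j f + partial j g"
proof (rule poly3_eqI)
  fix x
  have "((\<lambda>x. peval f x + peval g x) has_derivative (\<lambda>v. frechet_derivative (peval f) (at x) v
      + frechet_derivative (peval g) (at x) v)) (at x)"
    by (intro has_derivative_add) (simp_all add: peval_differentiable flip: frechet_derivative_works)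
  from frechet_derivative_at[OF this]
  show "peval (partial j (f + g)) x = peval (partial j f + partial j g) x"
    by (simp add: partial.rep_eq plus_poly3.rep_eq fun_eq_iff)
qed

lemma partial_scaleC: "partial j (c *\<^sub>C f) = c *\<^sub>C partial j f"
proof (rule poly3_eqI)
  fix x
  have "((\<lambda>x. c * peval f x) has_derivative (\<lambda>v. c * frechet_derivative (peval f) (at x) v)) (at x)"
    by (intro has_derivative_mult_right) (simp_all add: peval_differentiable flip: frechet_derivative_works)
  from frechet_derivative_at[OF this]
  show "peval (partial j (c *\<^sub>C f)) x = peval (c *\<^sub>C partial j f) x"
    by (simp add: partial.rep_eq scaleC_poly3.rep_eq fun_eq_iff)
qed


section \<open>Reflections and divided differences\<close>

definition reflection :: "real^3 \<Rightarrow> real^3 \<Rightarrow> real^3" where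
  "reflection \<alpha> x = x - (2 * (x \<bullet> \<alpha>) / (\<alpha> \<bullet> \<alpha>)) *\<^sub>R \<alpha>"

lemma linear_reflection: "linear (reflection \<alpha>)"
  unfolding reflection_def
  by (rule linearI) (auto simp: inner_add_left algebra_simps add_divide_distrib scaleR_add_left)

lemma reflection_reflection [simp]: "reflection \<alpha> (reflection \<alpha> x) = x"
  by (cases "\<alpha> = 0") (auto simp: reflection_def inner_diff_left algebra_simps)

lemma bij_reflection: "bij (reflection \<alpha>)"
  by (rule o_bij[of "reflection \<alpha>"]) (auto simp: fun_eq_iff)

lemma inv_reflection: "inv_into UNIV (reflection \<alpha>) = reflection \<alpha>"
  by (rule inv_unique_comp) (auto simp: fun_eq_iff)

text \<open>
  The guard only serves to make the definition total: it holds for all elements of a reflection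
  group, and without it the result need not be a polynomial.
\<close>
lift_definition group_act :: "(real^3 \<Rightarrow> real^3) \<Rightarrow> poly3 \<Rightarrow> poly3" is
  "\<lambda>w f x. if linear w \<and> bij w then f (inv_into UNIV w x) else f x"
proof -
  fix w :: "real^3 \<Rightarrow> real^3" and f :: "real^3 \<Rightarrow> complex"
  assume f: "polynomial_function f"
  show "polynomial_function (\<lambda>x. if linear w \<and> bij w then f (inv_into UNIV w x) else f x)"
  proof (cases "linear w \<and> bij w")
    case True
    then have "linear (inv_into UNIV w)"
      by (simp add: bij_is_inj inj_linear_imp_inv_linear)
    then have "polynomial_function (inv_into UNIV w)"
      by (simp add: polynomial_function_bounded_linear linear_conv_bounded_linear)
    with f have "polynomial_function (f \<circ> inv_into UNIV w)"
      by (intro polynomial_function_compose)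
    with True show ?thesis by (simp add: o_def)
  next
    case False
    then have "(\<lambda>x. if linear w \<and> bij w then f (inv_into UNIV w x) else f x) = f" by auto
    with f show ?thesis by simp
  qed
qed

lemma peval_group_act_reflection [simp]: "peval (group_act (reflection \<alpha>) f) x = peval f (reflection \<alpha> x)"
  by transfer (simp add: linear_reflection bij_reflection inv_reflection)

definition divided_difference :: "real^3 \<Rightarrow> poly3 \<Rightarrow> poly3" where
  "divided_difference \<alpha> f = (THE q. linear_form \<alpha> * q = f - group_act (reflection \<alpha>) f)"

lemma linear_form_mult_cancel:
  assumes "\<alpha> \<noteq> 0" "linear_form \<alpha> * p = linear_form \<alpha> * q"
  shows "p = q"
proof (rule poly3_eqI)
  fix x
  have eq: "peval p y = peval q y" if "y \<bullet> \<alpha> \<noteq> 0" for y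
    using arg_cong[OF assms(2), of "\<lambda>f. peval f y"] that by (simp add: linear_form.rep_eq)
  define h where "h t = peval p (x + t *\<^sub>R \<alpha>) - peval q (x + t *\<^sub>R \<alpha>)" for t :: real
  have cont: "isCont (\<lambda>t. peval f (x + t *\<^sub>R \<alpha>)) 0" for f
    by (rule isCont_o2[where g = "peval f"])
       (auto intro!: differentiable_imp_continuous_within peval_differentiable continuous_intros)
  have "isCont h 0" unfolding h_def by (intro continuous_intros cont)
  then have lim: "(h \<longlongrightarrow> h 0) (at 0)" by (simp add: isCont_def)
  have "eventually (\<lambda>t. t \<noteq> - (x \<bullet> \<alpha>) / (\<alpha> \<bullet> \<alpha>)) (at (0::real))"
    by (rule eventually_neq_at_within)
  then have "eventually (\<lambda>t. h t = 0) (at 0)"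
  proof eventually_elim
    case (elim t)
    then have "(x + t *\<^sub>R \<alpha>) \<bullet> \<alpha> \<noteq> 0"
      using assms(1) by (auto simp: inner_add_left field_simps add_eq_0_iff2)
    then show ?case by (simp add: h_def eq)
  qed
  then have "(h \<longlongrightarrow> 0) (at 0)" by (simp add: tendsto_eventually)
  with lim have "h 0 = 0" using tendsto_unique by (metis at_neq_bot)
  then show "peval p x = peval q x" by (simp add: h_def)
qed

lemma real_divided_difference_ex:
  assumes "real_polynomial_function f" "\<alpha> \<noteq> 0"
  shows "\<exists>q. real_polynomial_function q \<and> (\<forall>x. (x \<bullet> \<alpha>) * q x = f x - f (reflection \<alpha> x))"
  using assms(1)
proof induction
  case (linear f)
  then have "f (reflection \<alpha> x) = f x - (2 * (x \<bullet> \<alpha>) / (\<alpha> \<bullet> \<alpha>)) * f \<alpha>" for x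
    by (simp add: reflection_def bounded_linear.linear linear_diff linear_scale)
  then show ?case
    by (intro exI[of _ "\<lambda>_. 2 * f \<alpha> / (\<alpha> \<bullet> \<alpha>)"]) auto
next
  case (const c)
  show ?case by (intro exI[of _ "\<lambda>_. 0"]) auto
next
  case (add f g)
  then obtain p q where "real_polynomial_function p" "real_polynomial_function q"
    "\<forall>x. (x \<bullet> \<alpha>) * p x = f x - f (reflection \<alpha> x)" "\<forall>x. (x \<bullet> \<alpha>) * q x = g x - g (reflection \<alpha> x)" by blast
  then show ?case
    by (intro exI[of _ "\<lambda>x. p x + q x"]) (auto simp: distrib_left)
next
  case (mult f g)
  then obtain p q where pq: "real_polynomial_function p" "real_polynomial_function q"
    "\<And>x. (x \<bullet> \<alpha>) * p x = f x - f (reflection \<alpha> x)" "\<And>x. (x \<bullet> \<alpha>) * q x = g x - g (reflection \<alpha> x)" by blast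
  have "polynomial_function (reflection \<alpha>)"
    by (simp add: polynomial_function_bounded_linear linear_conv_bounded_linear[symmetric] linear_reflection)
  from real_polynomial_function_compose[OF this mult.hyps(1)]
  have f: "real_polynomial_function (\<lambda>x. f (reflection \<alpha> x))" by (simp add: o_def)
  have "(x \<bullet> \<alpha>) * (p x * g x + f (reflection \<alpha> x) * q x) = f x * g x - f (reflection \<alpha> x) * g (reflection \<alpha> x)" for x
  proof -
    have "(x \<bullet> \<alpha>) * (p x * g x + f (reflection \<alpha> x) * q x)
        = ((x \<bullet> \<alpha>) * p x) * g x + f (reflection \<alpha> x) * ((x \<bullet> \<alpha>) * q x)" by (simp add: algebra_simps)
    also have "\<dots> = f x * g x - f (reflection \<alpha> x) * g (reflection \<alpha> x)" unfolding pq by (simp add: algebra_simps)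
    finally show ?thesis .
  qed
  with pq f mult.hyps show ?case
    by (intro exI[of _ "\<lambda>x. p x * g x + f (reflection \<alpha> x) * q x"]) auto
qed

lemma divided_difference_ex:
  assumes "\<alpha> \<noteq> 0"
  shows "\<exists>q. linear_form \<alpha> * q = f - group_act (reflection \<alpha>) f"
proof -
  have pf: "real_polynomial_function (\<lambda>x. Re (peval f x))" "real_polynomial_function (\<lambda>x. Im (peval f x))"
    using peval[of f] by (auto simp: polynomial_function_complex_iff)
  obtain r i where ri: "real_polynomial_function r" "real_polynomial_function i"
    "\<And>x. (x \<bullet> \<alpha>) * r x = Re (peval f x) - Re (peval f (reflection \<alpha> x))"
    "\<And>x. (x \<bullet> \<alpha>) * i x = Im (peval f x) - Im (peval f (reflection \<alpha> x))"
    using real_divided_difference_ex[OF pf(1) assms] real_divided_difference_ex[OF pf(2) assms]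
    by metis
  define q where "q = Abs_poly3 (\<lambda>x. Complex (r x) (i x))"
  have "peval q = (\<lambda>x. Complex (r x) (i x))"
    unfolding q_def using ri(1,2) by (intro Abs_poly3_inverse) (simp add: polynomial_function_complex_iff)
  then have "linear_form \<alpha> * q = f - group_act (reflection \<alpha>) f"
    by (intro poly3_eqI) (simp add: linear_form.rep_eq complex_eq_iff ri)
  then show ?thesis ..
qed

lemma divided_difference:
  assumes "\<alpha> \<noteq> 0"
  shows "linear_form \<alpha> * divided_difference \<alpha> f = f - group_act (reflection \<alpha>) f"
proof -
  have "\<exists>!q. linear_form \<alpha> * q = f - group_act (reflection \<alpha>) f"
    using divided_difference_ex[OF assms, of f] linear_form_mult_cancel[OF assms] by metis
  then show ?thesis unfolding divided_difference_def by (rule theI')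
qed

lemma divided_difference_add:
  assumes "\<alpha> \<noteq> 0"
  shows "divided_difference \<alpha> (f + g) = divided_difference \<alpha> f + divided_difference \<alpha> g"
  by (rule linear_form_mult_cancel[OF assms])
     (auto simp: divided_difference assms distrib_left intro: poly3_eqI)

lemma divided_difference_scaleC:
  assumes "\<alpha> \<noteq> 0"
  shows "divided_difference \<alpha> (c *\<^sub>C f) = c *\<^sub>C divided_difference \<alpha> f"
  by (rule linear_form_mult_cancel[OF assms])
     (auto simp: divided_difference assms mult_scaleC_right right_diff_distrib intro: poly3_eqI)


section \<open>The root system and its reflection group\<close>

definition root_vec :: "nat \<Rightarrow> nat \<Rightarrow> real^3" where
  "root_vec m j = (if j = 0 then vector [0, 0, 1]
               else vector [sin (real j * pi / real m), - cos (real j * pi / real m), 0])"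

definition roots :: "nat \<Rightarrow> (real^3) set" where
  "roots m = {root_vec m 0, - root_vec m 0} \<union> root_vec m ` {1..2 * m}"

definition pos_roots :: "nat \<Rightarrow> (real^3) set" where
  "pos_roots m = root_vec m ` {0..m}"

definition reflection_group :: "nat \<Rightarrow> (real^3 \<Rightarrow> real^3) set" where
  "reflection_group m = generate (BijGroup UNIV) (reflection ` roots m)"

lemma inner_root_vec_self [simp]: "root_vec m j \<bullet> root_vec m j = 1"
  by (simp add: root_vec_def inner_vec_def sum_3 vector_3 flip: power2_eq_square)

lemma pos_roots_nonzero: "\<alpha> \<in> pos_roots m \<Longrightarrow> \<alpha> \<noteq> 0"
  by (metis imageE inner_root_vec_self inner_zero_left pos_roots_def zero_neq_one)


section \<open>Operators on polynomials\<close>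

typedef poly_op =
  "{T :: poly3 \<Rightarrow> poly3. (\<forall>f g. T (f + g) = T f + T g) \<and> (\<forall>c f. T (c *\<^sub>C f) = c *\<^sub>C T f)}"
  morphisms op_apply Abs_poly_op
  by (rule exI[of _ id]) simp

setup_lifting type_definition_poly_op

instantiation poly_op :: ring_1
begin
lift_definition zero_poly_op :: poly_op is "\<lambda>_. 0" by simp
lift_definition one_poly_op :: poly_op is "\<lambda>f. f" by simp
lift_definition plus_poly_op :: "poly_op \<Rightarrow> poly_op \<Rightarrow> poly_op" is "\<lambda>S T f. S f + T f"
  by (simp add: scaleC_add_right)
lift_definition minus_poly_op :: "poly_op \<Rightarrow> poly_op \<Rightarrow> poly_op" is "\<lambda>S T f. S f - T f"
  by (simp add: scaleC_diff_right)
lift_definition uminus_poly_op :: "poly_op \<Rightarrow> poly_op" is "\<lambda>S f. - S f"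
  by (simp add: scaleC_minus_right)
lift_definition times_poly_op :: "poly_op \<Rightarrow> poly_op \<Rightarrow> poly_op" is "\<lambda>S T f. S (T f)"
  by simp
instance
proof
  show "(0::poly_op) \<noteq> 1"
    by transfer (metis zero_neq_one)
qed (transfer; auto simp: algebra_simps)+
end

instantiation poly_op :: complex_algebra_1
begin
lift_definition scaleC_poly_op :: "complex \<Rightarrow> poly_op \<Rightarrow> poly_op" is "\<lambda>c T f. c *\<^sub>C T f"
  by (simp add: scaleC_add_right scaleC_scaleC mult.commute)
instance
  by standard
     (transfer; auto simp: scaleC_add_right scaleC_add_left scaleC_scaleC scaleC_one)+
end

lift_definition coord_op :: "3 \<Rightarrow> poly_op" is "\<lambda>j f. coord j * f"
  by (simp add: distrib_left mult_scaleC_right)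

lift_definition group_op :: "(real^3 \<Rightarrow> real^3) \<Rightarrow> poly_op" is group_act
  by (auto intro!: poly3_eqI simp: group_act.rep_eq)

lift_definition dunkl_op :: "nat \<Rightarrow> (real^3 \<Rightarrow> complex) \<Rightarrow> 3 \<Rightarrow> poly_op" is
  "\<lambda>m \<kappa> j f. partial j f
     + (\<Sum>\<alpha>\<in>pos_roots m. (\<kappa> \<alpha> * complex_of_real (\<alpha> $ j)) *\<^sub>C divided_difference \<alpha> f)"
  by (auto simp: partial_add partial_scaleC divided_difference_add divided_difference_scaleC
      pos_roots_nonzero scaleC_add_right scaleC_scaleC scaleC_sum_right sum.distrib mult_ac
      cong: sum.cong)

inductive_set dunkl_algebra :: "nat \<Rightarrow> (real^3 \<Rightarrow> complex) \<Rightarrow> poly_op set" for m \<kappa> where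
  dunkl: "dunkl_op m \<kappa> j \<in> dunkl_algebra m \<kappa>"
| coord: "coord_op j \<in> dunkl_algebra m \<kappa>"
| group: "w \<in> reflection_group m \<Longrightarrow> group_op w \<in> dunkl_algebra m \<kappa>"
| one: "1 \<in> dunkl_algebra m \<kappa>"
| add: "S \<in> dunkl_algebra m \<kappa> \<Longrightarrow> T \<in> dunkl_algebra m \<kappa> \<Longrightarrow> S + T \<in> dunkl_algebra m \<kappa>"
| mult: "S \<in> dunkl_algebra m \<kappa> \<Longrightarrow> T \<in> dunkl_algebra m \<kappa> \<Longrightarrow> S * T \<in> dunkl_algebra m \<kappa>"
| scale: "S \<in> dunkl_algebra m \<kappa> \<Longrightarrow> c *\<^sub>C S \<in> dunkl_algebra m \<kappa>"

lemma dunkl_algebra_diff: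
  assumes "S \<in> dunkl_algebra m \<kappa>" "T \<in> dunkl_algebra m \<kappa>"
  shows "S - T \<in> dunkl_algebra m \<kappa>"
proof -
  have "S + (-1) *\<^sub>C T = S - T"
    using scaleC_add_left[of 1 "-1" T] by (simp add: scaleC_one add_eq_0_iff)
  then show ?thesis using assms by (metis dunkl_algebra.add dunkl_algebra.scale)
qed

lemma dunkl_algebra_zero: "0 \<in> dunkl_algebra m \<kappa>"
  using dunkl_algebra_diff[OF dunkl_algebra.one dunkl_algebra.one] by simp


section \<open>Clifford algebras with coefficients\<close>

text \<open>
  For a complex algebra \<open>A\<close>, the tensor product of \<open>A\<close> with the Clifford algebra on \<open>e\<^sub>1, e\<^sub>2, e\<^sub>3\<close>
  is a free \<open>A\<close>-module on the eight blades \<open>e\<^sub>S\<close>, where \<open>e\<^sub>S\<close> is the product of the \<open>e\<^sub>j\<close> with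
  \<open>j \<in> S\<close> in increasing order; \<open>coef X S\<close> is the coefficient of \<open>X\<close> at \<open>e\<^sub>S\<close>. The order
  used is that of the type \<open>3\<close>, where the numeral \<open>3\<close> denotes \<open>0\<close> and hence \<open>3 < 1 < 2\<close>; another
  order would only change the signs of some basis elements. The parameter \<open>\<epsilon>\<close> enters through the
  multiplication only.
\<close>

typedef 'a clifford = "UNIV :: (3 set \<Rightarrow> 'a) set"
  morphisms coef Clifford ..

setup_lifting type_definition_clifford

lemma clifford_eqI: "(\<And>S. coef X S = coef Y S) \<Longrightarrow> X = Y"
  by (metis ext coef_inject)

instantiation clifford :: (complex_vector) complex_vector
begin
lift_definition zero_clifford :: "'a clifford" is "\<lambda>_. 0" .
lift_definition plus_clifford :: "'a clifford \<Rightarrow> 'a clifford \<Rightarrow> 'a clifford" is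
  "\<lambda>X Y S. X S + Y S" .
lift_definition minus_clifford :: "'a clifford \<Rightarrow> 'a clifford \<Rightarrow> 'a clifford" is
  "\<lambda>X Y S. X S - Y S" .
lift_definition uminus_clifford :: "'a clifford \<Rightarrow> 'a clifford" is "\<lambda>X S. - X S" .
lift_definition scaleC_clifford :: "complex \<Rightarrow> 'a clifford \<Rightarrow> 'a clifford" is
  "\<lambda>c X S. c *\<^sub>C X S" .
instance
  by standard
     (transfer; auto simp: algebra_simps scaleC_add_right scaleC_add_left scaleC_scaleC scaleC_one)+
end

lemma coef_simps [simp]:
  "coef 0 S = 0" "coef (X + Y) S = coef X S + coef Y S" "coef (X - Y) S = coef X S - coef Y S"
  "coef (- X) S = - coef X S" "coef (c *\<^sub>C X) S = c *\<^sub>C coef X S"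
  by (transfer; simp)+

lemma coef_sum [simp]: "coef (\<Sum>i\<in>I. X i) S = (\<Sum>i\<in>I. coef (X i) S)"
  by (induction I rule: infinite_finite_induct) auto

lift_definition blade :: "'a::zero \<Rightarrow> 3 set \<Rightarrow> 'a clifford" is
  "\<lambda>a S T. if T = S then a else 0" .

definition embed :: "'a::zero \<Rightarrow> 'a clifford" where
  "embed a = blade a {}"

definition gen :: "3 \<Rightarrow> 'a::{zero,one} clifford" where
  "gen j = blade 1 {j}"

instantiation clifford :: ("{zero,one}") one
begin
definition one_clifford :: "'a clifford" where "1 = embed 1"
instance ..
end

text \<open>
  \<open>blade_sign \<epsilon> S T\<close> is the scalar \<open>c\<close> with \<open>e\<^sub>S e\<^sub>T = c e\<^sub>U\<close>, \<open>U\<close> being the symmetric difference of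
  \<open>S\<close> and \<open>T\<close>: each inversion contributes \<open>-1\<close>, each cancelled pair \<open>e\<^sub>j e\<^sub>j\<close> contributes \<open>\<epsilon>\<close>.
\<close>
definition blade_sign :: "complex \<Rightarrow> 3 set \<Rightarrow> 3 set \<Rightarrow> complex" where
  "blade_sign \<epsilon> S T = (- 1) ^ card {(s, t) \<in> S \<times> T. t < s} * \<epsilon> ^ card (S \<inter> T)"

lift_definition cmult ::
  "complex \<Rightarrow> 'a::complex_algebra_1 clifford \<Rightarrow> 'a clifford \<Rightarrow> 'a clifford" is
  "\<lambda>\<epsilon> X Y U. \<Sum>(S, T)\<in>{(S, T). sym_diff S T = U}. blade_sign \<epsilon> S T *\<^sub>C (X S * Y T)" .

abbreviation cmult_syntax  ("(_ /\<star>[_] _)" [70, 0, 71] 70) where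
  "X \<star>[\<epsilon>] Y \<equiv> cmult \<epsilon> X Y"

abbreviation csquare :: "complex \<Rightarrow> 'a::complex_algebra_1 clifford \<Rightarrow> 'a clifford" where
  "csquare \<epsilon> X \<equiv> X \<star>[\<epsilon>] X"

lemma sym_diff_cancel: "sym_diff S (sym_diff S T) = T"
  by blast

lemma coef_cmult:
  "coef (X \<star>[\<epsilon>] Y) U =
     (\<Sum>S\<in>UNIV. blade_sign \<epsilon> S (sym_diff S U) *\<^sub>C (coef X S * coef Y (sym_diff S U)))"
  unfolding cmult.rep_eq
  by (rule sum.reindex_bij_witness[where i = "\<lambda>S. (S, sym_diff S U)" and j = fst])
     (auto simp only: fst_conv sym_diff_cancel mem_Collect_eq case_prod_conv UNIV_I)

lemma cmult_distrib:
  "(X + Y) \<star>[\<epsilon>] Z = X \<star>[\<epsilon>] Z + Y \<star>[\<epsilon>] Z"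
  "Z \<star>[\<epsilon>] (X + Y) = Z \<star>[\<epsilon>] X + Z \<star>[\<epsilon>] Y"
  by (auto intro!: clifford_eqI
      simp: coef_cmult distrib_left distrib_right scaleC_add_right sum.distrib)

lemma cmult_scaleC:
  "(c *\<^sub>C X) \<star>[\<epsilon>] Y = c *\<^sub>C (X \<star>[\<epsilon>] Y)"
  "X \<star>[\<epsilon>] (c *\<^sub>C Y) = c *\<^sub>C (X \<star>[\<epsilon>] Y)"
  by (auto intro!: clifford_eqI simp: coef_cmult mult_scaleC_left mult_scaleC_right
      scaleC_scaleC scaleC_sum_right mult.commute)

lemma blade_cmult_blade:
  "blade a S \<star>[\<epsilon>] blade b T = blade (blade_sign \<epsilon> S T *\<^sub>C (a * b)) (sym_diff S T)"
proof (rule clifford_eqI)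
  fix U
  have "coef (blade a S \<star>[\<epsilon>] blade b T) U =
      (\<Sum>R\<in>UNIV. if R = S then blade_sign \<epsilon> S (sym_diff S U) *\<^sub>C (a * coef (blade b T) (sym_diff S U)) else 0)"
    unfolding coef_cmult by (intro sum.cong) (auto simp: blade.rep_eq)
  also have "\<dots> = blade_sign \<epsilon> S (sym_diff S U) *\<^sub>C (a * coef (blade b T) (sym_diff S U))"
    by simp
  also have "\<dots> = coef (blade (blade_sign \<epsilon> S T *\<^sub>C (a * b)) (sym_diff S T)) U"
  proof (cases "U = sym_diff S T")
    case True
    then have "sym_diff S U = T" by (simp only: sym_diff_cancel)
    with True show ?thesis by (simp add: blade.rep_eq)
  next
    case False
    then have "sym_diff S U \<noteq> T" using sym_diff_cancel[of S U] by metis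
    with False show ?thesis by (simp add: blade.rep_eq)
  qed
  finally show "coef (blade a S \<star>[\<epsilon>] blade b T) U
      = coef (blade (blade_sign \<epsilon> S T *\<^sub>C (a * b)) (sym_diff S T)) U" .
qed

lemma blade_sign_empty [simp]: "blade_sign \<epsilon> {} S = 1" "blade_sign \<epsilon> S {} = 1"
  by (simp_all add: blade_sign_def)

lemma blade_sign_single:
  "blade_sign \<epsilon> {j} {k} = (if j = k then \<epsilon> else if k < j then - 1 else 1)"
proof -
  have "{(s, t) \<in> {j} \<times> {k}. t < s} = (if k < j then {(j, k)} else {})" by auto
  then show ?thesis by (auto simp: blade_sign_def)
qed

lemma clifford_relation:
  "gen j \<star>[\<epsilon>] gen k + gen k \<star>[\<epsilon>] gen j = (if j = k then 2 * \<epsilon> else 0) *\<^sub>C (1 :: 'a::complex_algebra_1 clifford)"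
proof (cases "j = k")
  case True
  have "coef (gen k \<star>[\<epsilon>] gen k) S = \<epsilon> *\<^sub>C coef (1 :: 'a clifford) S" for S
    unfolding gen_def blade_cmult_blade blade_sign_single
    by (simp add: blade.rep_eq one_clifford_def embed_def)
  with True show ?thesis
    by (intro clifford_eqI) (simp only: coef_simps simp_thms if_True mult_2[of \<epsilon>] scaleC_add_left)
next
  case False
  have "sym_diff {k} {j} = sym_diff {j} {k}" by (simp only: Un_commute)
  then have "coef (gen j \<star>[\<epsilon>] gen k + gen k \<star>[\<epsilon>] gen j) S =
      (if S = sym_diff {j} {k} then (blade_sign \<epsilon> {j} {k} + blade_sign \<epsilon> {k} {j}) *\<^sub>C (1::'a) else 0)" for S
    unfolding gen_def blade_cmult_blade coef_simps by (simp only: blade.rep_eq) (simp add: scaleC_add_left)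
  moreover have "blade_sign \<epsilon> {j} {k} + blade_sign \<epsilon> {k} {j} = 0"
    using False by (auto simp: blade_sign_single)
  ultimately show ?thesis
    using False by (intro clifford_eqI) (simp only: coef_simps scaleC_zero_left if_False if_cancel)
qed

lemma gen_cmult_blade:
  assumes "\<And>k. k \<in> S \<Longrightarrow> j < k"
  shows "gen j \<star>[\<epsilon>] blade (a :: 'a::complex_algebra_1) S = blade a (insert j S)"
proof -
  have "{(s, t) \<in> {j} \<times> S. t < s} = {}" "{j} \<inter> S = {}" using assms by force+
  then have "blade_sign \<epsilon> {j} S = 1" by (simp only: blade_sign_def) simp
  moreover have "sym_diff {j} S = insert j S" using \<open>{j} \<inter> S = {}\<close> by blast
  ultimately show ?thesis
    by (simp only: gen_def blade_cmult_blade scaleC_one mult_1_left)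
qed

lemma embed_cmult: "embed a \<star>[\<epsilon>] embed b = embed (a * b)"
  by (simp add: embed_def blade_cmult_blade scaleC_one)

lemma embed_cmult_gen: "embed a \<star>[\<epsilon>] gen j = gen j \<star>[\<epsilon>] embed a"
  by (simp add: embed_def gen_def blade_cmult_blade)

lemma cmult_one: "1 \<star>[\<epsilon>] X = X" "X \<star>[\<epsilon>] 1 = X"
proof -
  show "1 \<star>[\<epsilon>] X = X"
  proof (rule clifford_eqI)
    fix U
    have "coef (1 \<star>[\<epsilon>] X) U = (\<Sum>S\<in>(UNIV :: 3 set set). if S = {} then coef X U else 0)"
      unfolding coef_cmult
      by (intro sum.cong) (auto simp: one_clifford_def embed_def blade.rep_eq scaleC_one)
    then show "coef (1 \<star>[\<epsilon>] X) U = coef X U" by simp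
  qed
  show "X \<star>[\<epsilon>] 1 = X"
  proof (rule clifford_eqI)
    fix U
    have "coef (X \<star>[\<epsilon>] 1) U = (\<Sum>S\<in>UNIV. if S = U then coef X U else 0)"
      unfolding coef_cmult
      by (intro sum.cong) (auto simp: one_clifford_def embed_def blade.rep_eq scaleC_one)
    then show "coef (X \<star>[\<epsilon>] 1) U = coef X U" by simp
  qed
qed

lemma minus_one_power_card_sym_diff:
  assumes "finite S" "finite T"
  shows "(- 1 :: complex) ^ card (sym_diff S T) = (- 1) ^ card S * (- 1) ^ card T"
proof -
  have "card S = card (S - T) + card (S \<inter> T)" "card T = card (T - S) + card (S \<inter> T)"
    using card_Int_Diff[OF assms(1), of T] card_Int_Diff[OF assms(2), of S]
    by (simp_all only: Int_commute add.commute)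
  moreover have "card (sym_diff S T) = card (S - T) + card (T - S)"
    using assms by (intro card_Un_disjoint) auto
  ultimately show ?thesis by (simp add: power_add flip: power_mult_distrib)
qed

lemma blade_sign_cocycle:
  "blade_sign \<epsilon> S T * blade_sign \<epsilon> (sym_diff S T) U = blade_sign \<epsilon> T U * blade_sign \<epsilon> S (sym_diff T U)"
proof -
  define I where "I S T = {(s, t) \<in> S \<times> T. t < s}" for S T :: "3 set"
  have "I (sym_diff S T) U = sym_diff (I S U) (I T U)"
    "I S (sym_diff T U) = sym_diff (I S T) (I S U)"
    unfolding I_def by blast+
  then have I: "(- 1 :: complex) ^ card (I (sym_diff S T) U) = (- 1) ^ card (I S U) * (- 1) ^ card (I T U)"
    "(- 1 :: complex) ^ card (I S (sym_diff T U)) = (- 1) ^ card (I S T) * (- 1) ^ card (I S U)"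
    by (simp_all only: minus_one_power_card_sym_diff finite)
  have "card (S \<inter> T) + card (sym_diff S T \<inter> U) = card ((S \<inter> T) \<union> (sym_diff S T \<inter> U))"
    by (rule card_Un_disjoint[symmetric]) auto
  also have "(S \<inter> T) \<union> (sym_diff S T \<inter> U) = (T \<inter> U) \<union> (S \<inter> sym_diff T U)" by blast
  also have "card \<dots> = card (T \<inter> U) + card (S \<inter> sym_diff T U)"
    by (rule card_Un_disjoint) auto
  finally have \<epsilon>: "\<epsilon> ^ card (S \<inter> T) * \<epsilon> ^ card (sym_diff S T \<inter> U)
      = \<epsilon> ^ card (T \<inter> U) * \<epsilon> ^ card (S \<inter> sym_diff T U)"
    by (simp only: flip: power_add)
  have "x * p * ((y * z) * q) = z * r * ((x * y) * t)" if "p * q = r * t"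
    for x y z p q r t :: complex
    using arg_cong[OF that, of "\<lambda>u. x * y * z * u"] by (simp only: mult_ac)
  from this[OF \<epsilon>] show ?thesis
    unfolding blade_sign_def I_def[symmetric] I .
qed

lemma cmult_assoc: "(X \<star>[\<epsilon>] Y) \<star>[\<epsilon>] Z = X \<star>[\<epsilon>] (Y \<star>[\<epsilon>] Z)"
proof (rule clifford_eqI)
  fix D
  let ?f = "\<lambda>A E. (blade_sign \<epsilon> A (sym_diff A E) * blade_sign \<epsilon> E (sym_diff E D)) *\<^sub>C
      (coef X A * coef Y (sym_diff A E) * coef Z (sym_diff E D))"
  have cocycle: "blade_sign \<epsilon> A (sym_diff A E) * blade_sign \<epsilon> E (sym_diff E D)
      = blade_sign \<epsilon> A (sym_diff A D) * blade_sign \<epsilon> (sym_diff A E) (sym_diff E D)" for A E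
  proof -
    have "sym_diff (sym_diff A E) (sym_diff E D) = sym_diff A D" by blast
    then show ?thesis
      using blade_sign_cocycle[of \<epsilon> A "sym_diff A E" "sym_diff E D"]
      by (simp only: sym_diff_cancel mult.commute)
  qed
  have "coef ((X \<star>[\<epsilon>] Y) \<star>[\<epsilon>] Z) D = (\<Sum>E\<in>UNIV. \<Sum>A\<in>UNIV. ?f A E)"
    by (simp only: coef_cmult sum_distrib_right scaleC_sum_right mult_scaleC_left scaleC_scaleC mult.commute)
  also have "\<dots> = (\<Sum>A\<in>UNIV. \<Sum>E\<in>UNIV. ?f A E)" by (rule sum.swap)
  also have "\<dots> = (\<Sum>A\<in>UNIV. \<Sum>B\<in>UNIV. (blade_sign \<epsilon> A (sym_diff A D) *
      blade_sign \<epsilon> B (sym_diff B (sym_diff A D))) *\<^sub>C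
      (coef X A * (coef Y B * coef Z (sym_diff B (sym_diff A D)))))"
  proof (rule sum.cong[OF refl])
    fix A
    have *: "sym_diff (sym_diff A E) (sym_diff A D) = sym_diff E D" for E by blast
    show "(\<Sum>E\<in>UNIV. ?f A E) = (\<Sum>B\<in>UNIV. (blade_sign \<epsilon> A (sym_diff A D) *
      blade_sign \<epsilon> B (sym_diff B (sym_diff A D))) *\<^sub>C
      (coef X A * (coef Y B * coef Z (sym_diff B (sym_diff A D)))))"
      by (rule sum.reindex_bij_witness[where i = "sym_diff A" and j = "sym_diff A"])
         (simp_all only: sym_diff_cancel * cocycle mult.assoc UNIV_I)
  qed
  also have "\<dots> = coef (X \<star>[\<epsilon>] (Y \<star>[\<epsilon>] Z)) D"
    by (simp only: coef_cmult sum_distrib_left scaleC_sum_right mult_scaleC_right scaleC_scaleC)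
  finally show "coef ((X \<star>[\<epsilon>] Y) \<star>[\<epsilon>] Z) D = coef (X \<star>[\<epsilon>] (Y \<star>[\<epsilon>] Z)) D" .
qed


section \<open>The symmetries\<close>

text \<open>Here \<open>\<alpha> $ j\<close> is the inner product of \<open>\<alpha>\<close> with the canonical basis vector \<open>axis j 1\<close>.\<close>

definition reflection_lift :: "complex \<Rightarrow> real^3 \<Rightarrow> poly_op clifford" where
  "reflection_lift \<epsilon> \<alpha> =
     embed (group_op (reflection \<alpha>)) \<star>[\<epsilon>] (\<Sum>j\<in>UNIV. complex_of_real (\<alpha> $ j) *\<^sub>C gen j)"

definition ang_mom :: "nat \<Rightarrow> (real^3 \<Rightarrow> complex) \<Rightarrow> 3 \<Rightarrow> 3 \<Rightarrow> poly_op" where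
  "ang_mom m \<kappa> i j = coord_op i * dunkl_op m \<kappa> j - coord_op j * dunkl_op m \<kappa> i"

definition sym1 :: "nat \<Rightarrow> (real^3 \<Rightarrow> complex) \<Rightarrow> complex \<Rightarrow> 3 \<Rightarrow> poly_op clifford" where
  "sym1 m \<kappa> \<epsilon> j = \<epsilon> *\<^sub>C (\<Sum>k=0..m. (\<kappa> (root_vec m k) * complex_of_real (root_vec m k $ j)) *\<^sub>C
     reflection_lift \<epsilon> (root_vec m k))"

definition sym2 :: "nat \<Rightarrow> (real^3 \<Rightarrow> complex) \<Rightarrow> complex \<Rightarrow> 3 \<Rightarrow> 3 \<Rightarrow> poly_op clifford" where
  "sym2 m \<kappa> \<epsilon> i j = embed (ang_mom m \<kappa> i j) + (\<epsilon> / 2) *\<^sub>C (gen i \<star>[\<epsilon>] gen j)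
     + sym1 m \<kappa> \<epsilon> i \<star>[\<epsilon>] gen j - sym1 m \<kappa> \<epsilon> j \<star>[\<epsilon>] gen i"

definition sym3 :: "nat \<Rightarrow> (real^3 \<Rightarrow> complex) \<Rightarrow> complex \<Rightarrow> poly_op clifford" where
  "sym3 m \<kappa> \<epsilon> =
     - (\<epsilon> / 2) *\<^sub>C (gen 1 \<star>[\<epsilon>] gen 2 \<star>[\<epsilon>] gen 3)
     - sym1 m \<kappa> \<epsilon> 1 \<star>[\<epsilon>] gen 2 \<star>[\<epsilon>] gen 3
     - sym1 m \<kappa> \<epsilon> 2 \<star>[\<epsilon>] gen 3 \<star>[\<epsilon>] gen 1
     - sym1 m \<kappa> \<epsilon> 3 \<star>[\<epsilon>] gen 1 \<star>[\<epsilon>] gen 2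
     + sym2 m \<kappa> \<epsilon> 1 2 \<star>[\<epsilon>] gen 3
     + sym2 m \<kappa> \<epsilon> 3 1 \<star>[\<epsilon>] gen 2
     + sym2 m \<kappa> \<epsilon> 2 3 \<star>[\<epsilon>] gen 1"

text \<open>
  The tensor product of a subalgebra \<open>A\<close> with the Clifford algebra, as a subset of
  \<open>'a clifford\<close>. All symmetries above lie in \<open>dunkl_clifford m \<kappa>\<close>.
\<close>

definition clifford_over :: "'a set \<Rightarrow> 'a clifford set" where
  "clifford_over A = {X. \<forall>S. coef X S \<in> A}"

abbreviation dunkl_clifford :: "nat \<Rightarrow> (real^3 \<Rightarrow> complex) \<Rightarrow> poly_op clifford set" where
  "dunkl_clifford m \<kappa> \<equiv> clifford_over (dunkl_algebra m \<kappa>)"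

lemma dunkl_algebra_sum: "(\<And>i. i \<in> I \<Longrightarrow> f i \<in> dunkl_algebra m \<kappa>) \<Longrightarrow> sum f I \<in> dunkl_algebra m \<kappa>"
  by (induction I rule: infinite_finite_induct) (auto intro: dunkl_algebra_zero dunkl_algebra.add)

lemma dunkl_clifford_closed:
  "X \<in> dunkl_clifford m \<kappa> \<Longrightarrow> Y \<in> dunkl_clifford m \<kappa> \<Longrightarrow> X + Y \<in> dunkl_clifford m \<kappa>"
  "X \<in> dunkl_clifford m \<kappa> \<Longrightarrow> Y \<in> dunkl_clifford m \<kappa> \<Longrightarrow> X - Y \<in> dunkl_clifford m \<kappa>"
  "X \<in> dunkl_clifford m \<kappa> \<Longrightarrow> Y \<in> dunkl_clifford m \<kappa> \<Longrightarrow> X \<star>[\<epsilon>] Y \<in> dunkl_clifford m \<kappa>"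
  "X \<in> dunkl_clifford m \<kappa> \<Longrightarrow> c *\<^sub>C X \<in> dunkl_clifford m \<kappa>"
  "(\<And>i. i \<in> I \<Longrightarrow> f i \<in> dunkl_clifford m \<kappa>) \<Longrightarrow> sum f I \<in> dunkl_clifford m \<kappa>"
  "a \<in> dunkl_algebra m \<kappa> \<Longrightarrow> embed a \<in> dunkl_clifford m \<kappa>"
  "gen j \<in> dunkl_clifford m \<kappa>"
  by (auto simp: clifford_over_def coef_cmult embed_def gen_def blade.rep_eq dunkl_algebra.one
      dunkl_algebra_zero intro!: dunkl_algebra_sum dunkl_algebra_diff dunkl_algebra.intros(5-7))

lemma reflection_lift_closed:
  assumes "k \<le> m"
  shows "reflection_lift \<epsilon> (root_vec m k) \<in> dunkl_clifford m \<kappa>"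
proof -
  have "root_vec m k \<in> roots m"
    using assms by (cases "k = 0") (auto simp: roots_def)
  then have "reflection (root_vec m k) \<in> reflection_group m"
    unfolding reflection_group_def by (blast intro: generate.incl)
  then show ?thesis
    unfolding reflection_lift_def by (intro dunkl_clifford_closed dunkl_algebra.group)
qed

lemma symmetries_closed:
  "sym1 m \<kappa> \<epsilon> i \<in> dunkl_clifford m \<kappa>"
  "sym2 m \<kappa> \<epsilon> i j \<in> dunkl_clifford m \<kappa>"
  "sym3 m \<kappa> \<epsilon> \<in> dunkl_clifford m \<kappa>"
proof -
  show 1: "sym1 m \<kappa> \<epsilon> i \<in> dunkl_clifford m \<kappa>" for i
    unfolding sym1_def by (intro dunkl_clifford_closed reflection_lift_closed) simp
  show 2: "sym2 m \<kappa> \<epsilon> i j \<in> dunkl_clifford m \<kappa>" for i j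
    unfolding sym2_def ang_mom_def
    by (intro dunkl_clifford_closed 1 dunkl_algebra_diff dunkl_algebra.intros)
  show "sym3 m \<kappa> \<epsilon> \<in> dunkl_clifford m \<kappa>"
    unfolding sym3_def by (intro dunkl_clifford_closed 1 2)
qed

end

theory Submission
  imports Defs
begin

text \<open>
  Write \<open>M\<^sub>i\<^sub>j\<close> for the sum of \<open>\<kappa> \<alpha> \<alpha>\<^sub>i \<alpha>\<^sub>j \<sigma>\<^sub>\<alpha>\<close> over the positive roots \<open>\<alpha>\<close> (\<open>refl_form\<close>), so that
  \<open>[D\<^sub>i, x\<^sub>j] = \<delta>\<^sub>i\<^sub>j + 2 M\<^sub>i\<^sub>j\<close>, let \<open>t\<close> be the trace of \<open>M\<close>, and put \<open>L\<^sub>1 = L\<^sub>2\<^sub>3\<close>, \<open>L\<^sub>2 = L\<^sub>3\<^sub>1\<close>,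
  \<open>L\<^sub>3 = L\<^sub>1\<^sub>2\<close>. Let \<open>b\<^sub>1 = e\<^sub>2 e\<^sub>3\<close>, \<open>b\<^sub>2 = e\<^sub>3 e\<^sub>1\<close>, \<open>b\<^sub>3 = e\<^sub>1 e\<^sub>2\<close> be the quaternion units of the even
  subalgebra and \<open>\<omega> = e\<^sub>1 e\<^sub>2 e\<^sub>3\<close>, which is central with square \<open>- \<epsilon>\<close>. For \<open>(i, j, k)\<close> cyclic,

    \<open>O\<^sub>j = - \<epsilon> (\<Sum>\<^sub>l M\<^sub>j\<^sub>l b\<^sub>l) \<omega>\<close>,
    \<open>O\<^sub>j\<^sub>k = L\<^sub>i + \<epsilon> ((t + 1/2) b\<^sub>i - \<Sum>\<^sub>l M\<^sub>i\<^sub>l b\<^sub>l)\<close>,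
    \<open>O\<^sub>1\<^sub>2\<^sub>3 = (\<epsilon> (1 + t) - \<Sum>\<^sub>l L\<^sub>l b\<^sub>l) \<omega>\<close>

  (\<open>sym1_quat\<close>, \<open>sym2_quat\<close>, \<open>sym3_quat\<close>). Squaring in the quaternion algebra, the scalar parts of the
  two sides agree identically, and the difference of the coefficients of \<open>b\<^sub>k\<close> vanishes because

    \<open>[L\<^sub>i, L\<^sub>j] = - L\<^sub>k - \<Sum>\<^sub>l (L\<^sub>l M\<^sub>l\<^sub>k + M\<^sub>l\<^sub>k L\<^sub>l)\<close>

  (\<open>even_square_identity\<close>). This relation, \<open>angular_momentum_commutator\<close>, is a formal consequence of
  the commutators \<open>[D\<^sub>i, x\<^sub>j]\<close>, the symmetry of \<open>M\<close> and the commutativity of the \<open>x\<^sub>i\<close> and of the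
  Dunkl operators. So the root system enters in two places: through the formula for \<open>[D\<^sub>i, x\<^sub>j]\<close>, and
  through the commutativity \<open>[D\<^sub>i, D\<^sub>j] = 0\<close> (\<open>dunkl_dir_commute\<close>), which needs that the roots and \<open>\<kappa>\<close>
  are invariant under reflections.

  For \<open>[D\<^sub>i, D\<^sub>j] = 0\<close> no divided differences have to be composed: an operator on polynomials that
  kills \<open>1\<close> and commutes with all linear forms is zero, and the commutators of \<open>[D\<^sub>i, D\<^sub>j]\<close> with linear
  forms are computed from \<open>[D\<^sub>i, x\<^sub>j]\<close> by the Jacobi identity.
\<close>


section \<open>The roots under reflections\<close>

text \<open>
  The roots in the plane, indexed by a real angle instead of an index in \<open>{1..2 * m}\<close>. The period
  \<open>2 * pi\<close> then takes care of the wrap-around of indices.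
\<close>
definition planar :: "real \<Rightarrow> real^3" where
  "planar \<theta> = vector [sin \<theta>, - cos \<theta>, 0]"

lemma root_vec_planar: "j \<noteq> 0 \<Longrightarrow> root_vec m j = planar (real j * pi / real m)"
  by (simp add: root_vec_def planar_def)

lemma reflection_unit: "\<alpha> \<bullet> \<alpha> = 1 \<Longrightarrow> reflection \<alpha> x = x - (2 * (x \<bullet> \<alpha>)) *\<^sub>R \<alpha>"
  by (simp add: reflection_def)

lemma inner_planar: "planar a \<bullet> planar b = cos (a - b)"
  by (simp add: planar_def inner_vec_def sum_3 vector_3 cos_diff)

lemma reflection_planar: "reflection (planar a) (planar b) = planar (2 * a - b + pi)"
proof -
  have c: "cos (2 * a - b) = 2 * cos (b - a) * cos a - cos b"
    and s: "sin (2 * a - b) = 2 * cos (b - a) * sin a - sin b"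
    using cos_add[of a "a - b"] sin_add[of a "a - b"] cos_diff[of a "a - b"] sin_diff[of a "a - b"]
      cos_minus[of "a - b"]
    by (simp_all add: algebra_simps)
  have unit: "planar a \<bullet> planar a = 1" by (simp add: inner_planar)
  show ?thesis
    unfolding reflection_unit[OF unit] inner_planar
    by (simp add: vec_eq_iff forall_3 planar_def c s)
qed

text \<open>
  Shifting an integer index into \<open>{1..2 * m}\<close> changes the angle by a multiple of \<open>2 * pi\<close>.
\<close>
lemma planar_in_roots:
  fixes i :: int
  assumes "m \<ge> 1"
  shows "planar (of_int i * pi / real m) \<in> roots m"
proof -
  \<comment> \<open>The shifts by one select the residue in \<open>{1..2 * m}\<close> rather than in \<open>{0..<2 * m}\<close>.\<close>
  define r where "r = (i - 1) mod (2 * int m) + 1"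
  define n where "n = (i - 1) div (2 * int m)"
  have i: "i = r + n * (2 * int m)"
    using div_mult_mod_eq[of "i - 1" "2 * int m"] unfolding r_def n_def by linarith
  have "0 \<le> (i - 1) mod (2 * int m)" "(i - 1) mod (2 * int m) < 2 * int m"
    using assms by auto
  then have r: "1 \<le> r" "r \<le> 2 * int m"
    unfolding r_def by linarith+
  have "of_int i * pi / real m = of_int r * pi / real m + 2 * pi * of_int n"
    using assms by (simp add: i field_simps)
  then have "planar (of_int i * pi / real m) = planar (of_int r * pi / real m)"
    by (simp add: planar_def sin_add cos_add)
  also have "\<dots> = root_vec m (nat r)"
    using r by (simp add: root_vec_planar)
  also have "\<dots> \<in> roots m"
    using r unfolding roots_def by (intro UnI2 imageI) auto
  finally show ?thesis .
qed

lemma planar_add_pi: "planar (\<theta> + pi) = - planar \<theta>"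
  by (simp add: planar_def vec_eq_iff forall_3 vector_3)

lemma roots_cases:
  assumes "\<alpha> \<in> roots m"
  obtains "\<alpha> = root_vec m 0" | "\<alpha> = - root_vec m 0"
    | j :: int where "\<alpha> = planar (of_int j * pi / real m)"
proof -
  consider "\<alpha> = root_vec m 0" | "\<alpha> = - root_vec m 0" | j where "j \<in> {1..2*m}" "\<alpha> = root_vec m j"
    using assms by (auto simp: roots_def)
  then show thesis
  proof cases
    case 3
    then show thesis using that(3)[of "int j"] by (simp add: root_vec_planar)
  qed (use that in auto)
qed

lemma roots_unit: "\<alpha> \<in> roots m \<Longrightarrow> \<alpha> \<bullet> \<alpha> = 1"
  unfolding roots_def by auto

text \<open>
  The reflection in the planar root with index \<open>k\<close> fixes the two poles and acts on the indices of
  planar roots by \<open>j \<mapsto> 2 * k - j + m\<close>. The reflection in a pole fixes the plane and swaps the poles.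
\<close>
lemma reflection_in_roots:
  assumes "m \<ge> 1" "\<alpha> \<in> roots m" "\<beta> \<in> roots m"
  shows "reflection \<beta> \<alpha> \<in> roots m"
proof -
  have ortho: "root_vec m 0 \<bullet> planar \<theta> = 0" "planar \<theta> \<bullet> root_vec m 0 = 0" for \<theta>
    by (simp_all add: root_vec_def planar_def inner_vec_def sum_3 vector_3)
  have poles: "root_vec m 0 \<in> roots m" "- root_vec m 0 \<in> roots m"
    by (simp_all add: roots_def)
  note \<beta>1 = roots_unit[OF assms(3)]
  show ?thesis
    using assms(3)
  proof (cases rule: roots_cases)
    case 1
    with assms(2) poles show ?thesis
      by (cases rule: roots_cases)
        (auto simp: reflection_unit ortho scaleR_2 intro!: planar_in_roots assms(1))
  next
    case 2
    with assms(2) poles show ?thesis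
      by (cases rule: roots_cases)
        (auto simp: reflection_unit ortho scaleR_2 intro!: planar_in_roots assms(1))
  next
    case (3 k)
    show ?thesis
      using assms(2)
    proof (cases rule: roots_cases)
      case (3 j)
      have "2 * (of_int k * pi / real m) - of_int j * pi / real m + pi
          = of_int (2 * k - j + int m) * pi / real m"
        using assms(1) by (simp add: field_simps)
      with 3 \<open>\<beta> = _\<close> show ?thesis
        by (metis reflection_planar planar_in_roots assms(1))
    qed (use 3 poles \<beta>1 in \<open>auto simp: reflection_unit ortho\<close>)
  qed
qed

lemma roots_eq_pos_roots_Un:
  assumes "m \<ge> 1"
  shows "roots m = pos_roots m \<union> uminus ` pos_roots m"
proof -
  have neg: "root_vec m (j + m) = - root_vec m j" if "j \<ge> 1" for j
  proof -
    have "real (j + m) * pi / real m = real j * pi / real m + pi"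
      using assms by (simp add: field_simps)
    then show ?thesis
      using that by (simp add: root_vec_planar planar_add_pi)
  qed
  have "{1..2*m} = {1..m} \<union> (\<lambda>j. j + m) ` {1..m}"
    by (subst image_add_atLeastAtMost') auto
  then have "root_vec m ` {1..2*m} = root_vec m ` {1..m} \<union> (\<lambda>j. - root_vec m j) ` {1..m}"
    by (simp only: image_Un image_image) (simp add: neg cong: image_cong_simp)
  moreover have "{0..m} = insert 0 {1..m}" by auto
  ultimately show ?thesis
    unfolding roots_def pos_roots_def by (simp add: image_image) blast
qed

text \<open>
  Positivity for the lexicographic order that compares the third, the first and then the second
  coordinate. It holds for the positive roots and never for both \<open>\<alpha>\<close> and \<open>- \<alpha>\<close>, which makes the
  positive roots disjoint from their negatives.
\<close>
definition lex_positive :: "real^3 \<Rightarrow> bool" where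
  "lex_positive \<alpha> \<longleftrightarrow> \<alpha> $ 3 > 0 \<or> \<alpha> $ 3 = 0 \<and> (\<alpha> $ 1 > 0 \<or> \<alpha> $ 1 = 0 \<and> \<alpha> $ 2 > 0)"

lemma pos_roots_lex_positive:
  assumes "m \<ge> 1" "\<alpha> \<in> pos_roots m"
  shows "lex_positive \<alpha>"
proof -
  obtain j where j: "j \<le> m" "\<alpha> = root_vec m j" using assms(2) by (auto simp: pos_roots_def)
  consider "j = 0" | "0 < j" "j < m" | "j = m" using j by linarith
  then show ?thesis
  proof cases
    case 2
    then have "0 < real j * pi / real m" "real j * pi / real m < pi"
      by (simp_all add: field_simps)
    then have "sin (real j * pi / real m) > 0" by (rule sin_gt_zero)
    with 2 j show ?thesis by (simp add: lex_positive_def root_vec_def vector_3)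
  qed (use j assms(1) in \<open>simp_all add: lex_positive_def root_vec_def vector_3\<close>)
qed

lemma inj_on_root_vec:
  assumes "m \<ge> 1"
  shows "inj_on (root_vec m) {0..m}"
proof (rule inj_onI)
  fix j k assume jk: "j \<in> {0..m}" "k \<in> {0..m}" "root_vec m j = root_vec m k"
  then have z: "j = 0 \<longleftrightarrow> k = 0"
    by (auto simp: root_vec_def vec_eq_iff forall_3 vector_3 split: if_splits)
  show "j = k"
  proof (cases "j = 0")
    case False
    with jk z have "cos (real j * pi / real m) = cos (real k * pi / real m)"
      by (auto simp: root_vec_def vec_eq_iff forall_3 vector_3)
    moreover have "0 \<le> real i * pi / real m \<and> real i * pi / real m \<le> pi" if "i \<in> {0..m}" for i
      using that assms by (simp add: field_simps)
    ultimately have "real j * pi / real m = real k * pi / real m"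
      using jk(1,2) cos_inj_pi by blast
    then show ?thesis using assms by simp
  qed (use z in simp)
qed

text \<open>
  A reflection permutes the roots but not the positive ones. For an even summand, a sum over the
  positive roots is half the sum over all roots, and therefore still invariant.
\<close>
lemma sum_pos_roots_reflection:
  fixes F :: "real^3 \<Rightarrow> 'a::complex_vector"
  assumes m: "m \<ge> 1" and \<beta>: "\<beta> \<in> roots m"
    and even: "\<And>\<alpha>. \<alpha> \<in> roots m \<Longrightarrow> F (- \<alpha>) = F \<alpha>"
  shows "(\<Sum>\<alpha>\<in>pos_roots m. F (reflection \<beta> \<alpha>)) = (\<Sum>\<alpha>\<in>pos_roots m. F \<alpha>)"
proof -
  have fin: "finite (pos_roots m)" by (simp add: pos_roots_def)
  have disj: "pos_roots m \<inter> uminus ` pos_roots m = {}"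
    by (auto dest!: pos_roots_lex_positive[OF m] simp: lex_positive_def)
  have pos: "\<alpha> \<in> roots m" if "\<alpha> \<in> pos_roots m" for \<alpha>
    using that by (simp add: roots_eq_pos_roots_Un[OF m])
  have double: "(\<Sum>\<alpha>\<in>roots m. G \<alpha>) = 2 *\<^sub>C (\<Sum>\<alpha>\<in>pos_roots m. G \<alpha>)"
    if "\<And>\<alpha>. \<alpha> \<in> roots m \<Longrightarrow> G (- \<alpha>) = G \<alpha>" for G :: "real^3 \<Rightarrow> 'a"
  proof -
    have "(\<Sum>\<alpha>\<in>uminus ` pos_roots m. G \<alpha>) = (\<Sum>\<alpha>\<in>pos_roots m. G \<alpha>)"
      by (subst sum.reindex) (auto intro!: inj_onI sum.cong simp: that pos)
    then show ?thesis
      using scaleC_add_left[of 1 1 "\<Sum>\<alpha>\<in>pos_roots m. G \<alpha>"]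
      by (simp add: roots_eq_pos_roots_Un[OF m] sum.union_disjoint[OF fin finite_imageI[OF fin] disj] scaleC_one)
  qed
  have "(\<Sum>\<alpha>\<in>roots m. F (reflection \<beta> \<alpha>)) = (\<Sum>\<alpha>\<in>roots m. F \<alpha>)"
    by (rule sum.reindex_bij_witness[where i = "reflection \<beta>" and j = "reflection \<beta>"])
      (auto intro: reflection_in_roots m \<beta>)
  moreover have "F (reflection \<beta> (- \<alpha>)) = F (reflection \<beta> \<alpha>)" if "\<alpha> \<in> roots m" for \<alpha>
    using even[OF reflection_in_roots[OF m that \<beta>]] by (simp only: linear_neg[OF linear_reflection])
  ultimately have "2 *\<^sub>C (\<Sum>\<alpha>\<in>pos_roots m. F (reflection \<beta> \<alpha>)) = 2 *\<^sub>C (\<Sum>\<alpha>\<in>pos_roots m. F \<alpha>)"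
    using double[of F] double[of "\<lambda>\<alpha>. F (reflection \<beta> \<alpha>)"] even by simp
  from arg_cong[OF this, of "scaleC (1/2)"] show ?thesis
    by (simp add: scaleC_scaleC scaleC_one)
qed


section \<open>Commutators with linear forms\<close>

text \<open>
  Multiplication by a linear form. Working with directions \<open>v\<close> in place of coordinates lets
  reflections act on the index of an operator.
\<close>
lift_definition linear_op :: "real^3 \<Rightarrow> poly_op" is "\<lambda>v f. linear_form v * f"
  by (simp add: distrib_left mult_scaleC_right)

lemma coord_op_eq: "coord_op j = linear_op (axis j 1)"
proof -
  have "coord j = linear_form (axis j 1)"
    by (rule poly3_eqI) (simp add: coord.rep_eq linear_form.rep_eq inner_axis)
  then show ?thesis by transfer simp
qed

lemma poly_op_eqI: "(\<And>f. op_apply S f = op_apply T f) \<Longrightarrow> S = T"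
  by (metis ext op_apply_inject)

lemma op_apply_simps [simp]:
  "op_apply 0 f = 0" "op_apply 1 f = f" "op_apply (S + T) f = op_apply S f + op_apply T f"
  "op_apply (S - T) f = op_apply S f - op_apply T f" "op_apply (- S) f = - op_apply S f"
  "op_apply (S * T) f = op_apply S (op_apply T f)" "op_apply (c *\<^sub>C S) f = c *\<^sub>C op_apply S f"
  "op_apply (linear_op v) f = linear_form v * f"
  "op_apply (group_op w) f = group_act w f"
  by (transfer; simp)+

lemma op_apply_linear:
  "op_apply T (f + g) = op_apply T f + op_apply T g" "op_apply T (c *\<^sub>C f) = c *\<^sub>C op_apply T f"
  by (transfer; simp)+

lemma op_apply_zero [simp]: "op_apply T 0 = 0"
  using op_apply_linear(2)[of T 0 0] by simp

lemma op_apply_sum [simp]: "op_apply (\<Sum>i\<in>I. T i) f = (\<Sum>i\<in>I. op_apply (T i) f)"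
  by (induction I rule: infinite_finite_induct) auto

lemma poly3_induct [case_names linear one add mult scale]:
  assumes linear: "\<And>v. P (linear_form v)"
    and one: "P 1"
    and add: "\<And>f g. P f \<Longrightarrow> P g \<Longrightarrow> P (f + g)"
    and mult: "\<And>f g. P f \<Longrightarrow> P g \<Longrightarrow> P (f * g)"
    and scale: "\<And>c f. P f \<Longrightarrow> P (c *\<^sub>C f)"
  shows "P p"
proof -
  have real: "\<exists>p. (\<forall>x. peval p x = complex_of_real (f x)) \<and> P p"
    if "real_polynomial_function f" for f :: "real^3 \<Rightarrow> real"
    using that
  proof induction
    case (linear f)
    then have "f x = x \<bullet> adjoint f 1" for x
      using adjoint_works[of f x 1] by (simp add: bounded_linear.linear)
    then show ?case
      by (intro exI[of _ "linear_form (adjoint f 1)"]) (simp add: linear_form.rep_eq assms(1))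
  next
    case (const c)
    show ?case
      by (intro exI[of _ "complex_of_real c *\<^sub>C 1"]) (simp add: one scale)
  next
    case (add f g)
    then show ?case using assms(3) by (metis of_real_add peval_simps(3))
  next
    case (mult f g)
    then show ?case using assms(4) by (metis of_real_mult peval_simps(6))
  qed
  have "real_polynomial_function (\<lambda>x. Re (peval p x))" "real_polynomial_function (\<lambda>x. Im (peval p x))"
    using peval[of p] by (auto simp: polynomial_function_complex_iff)
  then obtain r s where rs: "\<And>x. peval r x = complex_of_real (Re (peval p x))" "P r"
      "\<And>x. peval s x = complex_of_real (Im (peval p x))" "P s"
    using real by metis
  have "p = r + \<i> *\<^sub>C s"
    by (rule poly3_eqI) (simp add: rs complex_eq)
  then show ?thesis using add[OF rs(2) scale[OF rs(4)]] by (simp only:)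
qed

text \<open>
  An operator that commutes with multiplication by linear forms commutes with all multiplications,
  so it is multiplication by its value at \<open>1\<close>. This reduces identities between differential-difference
  operators to their commutators with linear forms.
\<close>
lemma poly_op_zero_if_commutes:
  assumes comm: "\<And>v. T * linear_op v = linear_op v * T"
    and one: "op_apply T 1 = 0"
  shows "T = 0"
proof -
  have "\<forall>g. op_apply T (f * g) = f * op_apply T g" for f
  proof (induction f rule: poly3_induct)
    case (linear v)
    show ?case using arg_cong[OF comm[of v], of op_apply] by (auto dest: fun_cong)
  next
    case (mult f g)
    then show ?case by (simp add: mult.assoc)
  qed (simp_all add: distrib_right op_apply_linear mult_scaleC_left)
  from this[THEN spec, of _ 1] one show ?thesis
    by (intro poly_op_eqI) simp
qed

lemma partial_linear_form_mult:
  "partial j (linear_form v * f) = complex_of_real (v $ j) *\<^sub>C f + linear_form v * partial j f"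
proof (rule poly3_eqI)
  fix x
  have "((\<lambda>x. complex_of_real (x \<bullet> v) * peval f x) has_derivative
      (\<lambda>h. complex_of_real (x \<bullet> v) * frechet_derivative (peval f) (at x) h
        + complex_of_real (h \<bullet> v) * peval f x)) (at x)"
    by (intro has_derivative_mult has_derivative_of_real has_derivative_inner_left
        has_derivative_ident) (simp add: peval_differentiable flip: frechet_derivative_works)
  from fun_cong[OF frechet_derivative_at[OF this], of "axis j 1", symmetric]
  show "peval (partial j (linear_form v * f)) x
      = peval (complex_of_real (v $ j) *\<^sub>C f + linear_form v * partial j f) x"
    by (simp add: partial.rep_eq times_poly3.rep_eq linear_form.rep_eq inner_axis' add.commute)
qed

text \<open>
  The twisted Leibniz rule of divided differences; the extra term is the source of the reflections
  in the commutators below.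
\<close>
lemma divided_difference_linear_form_mult:
  assumes "\<alpha> \<bullet> \<alpha> = 1"
  shows "divided_difference \<alpha> (linear_form v * f) =
    linear_form v * divided_difference \<alpha> f + complex_of_real (2 * (\<alpha> \<bullet> v)) *\<^sub>C group_act (reflection \<alpha>) f"
proof -
  have nz: "\<alpha> \<noteq> 0" using assms by auto
  show ?thesis
  proof (rule linear_form_mult_cancel[OF nz], rule poly3_eqI)
    fix x
    have "peval (linear_form \<alpha>) x * peval (divided_difference \<alpha> f) x
        = peval f x - peval f (reflection \<alpha> x)"
      using arg_cong[OF divided_difference[OF nz, of f], of "\<lambda>p. peval p x"] by simp
    then have "peval f x = complex_of_real (x \<bullet> \<alpha>) * peval (divided_difference \<alpha> f) x
        + peval f (reflection \<alpha> x)"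
      by (simp add: linear_form.rep_eq)
    moreover have "complex_of_real (reflection \<alpha> x \<bullet> v)
        = complex_of_real (x \<bullet> v) - complex_of_real (x \<bullet> \<alpha>) * complex_of_real (2 * (\<alpha> \<bullet> v))"
      by (simp add: reflection_unit[OF assms] inner_diff_left)
    ultimately show "peval (linear_form \<alpha> * divided_difference \<alpha> (linear_form v * f)) x =
      peval (linear_form \<alpha> * (linear_form v * divided_difference \<alpha> f
        + complex_of_real (2 * (\<alpha> \<bullet> v)) *\<^sub>C group_act (reflection \<alpha>) f)) x"
      unfolding divided_difference[OF nz]
      by (simp only: peval_simps linear_form.rep_eq peval_group_act_reflection)
        (simp (no_asm) add: algebra_simps)
  qed
qed

lemma dunkl_op_one: "op_apply (dunkl_op m \<kappa> j) 1 = 0"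
proof -
  have "partial j 1 = 0"
    by (rule poly3_eqI) (simp add: partial.rep_eq one_poly3.rep_eq frechet_derivative_const)
  moreover have "divided_difference \<alpha> 1 = 0" if "\<alpha> \<in> pos_roots m" for \<alpha>
    by (rule linear_form_mult_cancel[OF pos_roots_nonzero[OF that]])
      (auto simp: divided_difference pos_roots_nonzero[OF that] intro: poly3_eqI)
  ultimately show ?thesis by (simp add: dunkl_op.rep_eq)
qed

definition dunkl_dir :: "nat \<Rightarrow> (real^3 \<Rightarrow> complex) \<Rightarrow> real^3 \<Rightarrow> poly_op" where
  "dunkl_dir m \<kappa> v = (\<Sum>j\<in>UNIV. complex_of_real (v $ j) *\<^sub>C dunkl_op m \<kappa> j)"

text \<open>
  The deformation of the Heisenberg relations: the commutator of the Dunkl operator in direction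
  \<open>v\<close> with the linear form of \<open>w\<close> exceeds the inner product by twice this operator-valued form.
\<close>
definition refl_form :: "nat \<Rightarrow> (real^3 \<Rightarrow> complex) \<Rightarrow> real^3 \<Rightarrow> real^3 \<Rightarrow> poly_op" where
  "refl_form m \<kappa> v w = (\<Sum>\<alpha>\<in>pos_roots m.
     (\<kappa> \<alpha> * complex_of_real ((\<alpha> \<bullet> v) * (\<alpha> \<bullet> w))) *\<^sub>C group_op (reflection \<alpha>))"

lemma refl_form_commute: "refl_form m \<kappa> v w = refl_form m \<kappa> w v"
  by (simp add: refl_form_def mult.commute)

lemma dunkl_op_eq: "dunkl_op m \<kappa> j = dunkl_dir m \<kappa> (axis j 1)"
proof -
  have "dunkl_dir m \<kappa> (axis j 1) = (\<Sum>i\<in>UNIV. if i = j then dunkl_op m \<kappa> i else 0)"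
    unfolding dunkl_dir_def by (intro sum.cong) (auto simp: axis_def scaleC_one)
  then show ?thesis by simp
qed

lemma dunkl_dir_linear:
  "dunkl_dir m \<kappa> (v - w) = dunkl_dir m \<kappa> v - dunkl_dir m \<kappa> w"
  "dunkl_dir m \<kappa> (c *\<^sub>R v) = complex_of_real c *\<^sub>C dunkl_dir m \<kappa> v"
  unfolding dunkl_dir_def
  by (simp_all add: module.scale_left_diff_distrib[OF module_scaleC] sum_subtractf scaleC_scaleC scaleC_sum_right)

lemma dunkl_dir_one: "op_apply (dunkl_dir m \<kappa> v) 1 = 0"
  by (simp add: dunkl_dir_def dunkl_op_one)

lemma pos_roots_unit: "\<alpha> \<in> pos_roots m \<Longrightarrow> \<alpha> \<bullet> \<alpha> = 1"
  by (auto simp: pos_roots_def)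

lemma op_apply_dunkl_dir:
  "op_apply (dunkl_dir m \<kappa> v) f = (\<Sum>j\<in>UNIV. complex_of_real (v $ j) *\<^sub>C partial j f)
     + (\<Sum>\<alpha>\<in>pos_roots m. (\<kappa> \<alpha> * complex_of_real (\<alpha> \<bullet> v)) *\<^sub>C divided_difference \<alpha> f)"
proof -
  have "op_apply (dunkl_dir m \<kappa> v) f = (\<Sum>j\<in>UNIV. complex_of_real (v $ j) *\<^sub>C partial j f)
     + (\<Sum>j\<in>UNIV. \<Sum>\<alpha>\<in>pos_roots m. (complex_of_real (v $ j) * (\<kappa> \<alpha> * complex_of_real (\<alpha> $ j))) *\<^sub>C divided_difference \<alpha> f)"
    by (simp add: dunkl_dir_def dunkl_op.rep_eq scaleC_add_right scaleC_sum_right scaleC_scaleC sum.distrib)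
  also have "(\<Sum>j\<in>UNIV. \<Sum>\<alpha>\<in>pos_roots m. (complex_of_real (v $ j) * (\<kappa> \<alpha> * complex_of_real (\<alpha> $ j))) *\<^sub>C divided_difference \<alpha> f)
    = (\<Sum>\<alpha>\<in>pos_roots m. (\<Sum>j\<in>UNIV. complex_of_real (v $ j) * (\<kappa> \<alpha> * complex_of_real (\<alpha> $ j))) *\<^sub>C divided_difference \<alpha> f)"
    by (subst sum.swap) (simp add: module.scale_sum_left[OF module_scaleC])
  also have "\<dots> = (\<Sum>\<alpha>\<in>pos_roots m. (\<kappa> \<alpha> * complex_of_real (\<alpha> \<bullet> v)) *\<^sub>C divided_difference \<alpha> f)"
    by (simp add: inner_vec_def sum_distrib_left mult_ac)
  finally show ?thesis .
qed

lemma dunkl_dir_linear_op: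
  "dunkl_dir m \<kappa> v * linear_op w - linear_op w * dunkl_dir m \<kappa> v
     = complex_of_real (v \<bullet> w) *\<^sub>C 1 + (refl_form m \<kappa> v w + refl_form m \<kappa> v w)"
proof (rule poly_op_eqI)
  fix f
  let ?P = "\<Sum>j\<in>UNIV. complex_of_real (v $ j) *\<^sub>C partial j f"
  let ?Q = "\<Sum>\<alpha>\<in>pos_roots m. (\<kappa> \<alpha> * complex_of_real (\<alpha> \<bullet> v)) *\<^sub>C divided_difference \<alpha> f"
  let ?R = "op_apply (refl_form m \<kappa> v w) f"
  have "(\<Sum>j\<in>UNIV. complex_of_real (v $ j) *\<^sub>C partial j (linear_form w * f))
      = complex_of_real (v \<bullet> w) *\<^sub>C f + linear_form w * ?P"
    by (simp add: partial_linear_form_mult scaleC_add_right scaleC_scaleC sum.distrib inner_vec_def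
        module.scale_sum_left[OF module_scaleC] sum_distrib_left mult_scaleC_right)
  moreover have "(\<Sum>\<alpha>\<in>pos_roots m. (\<kappa> \<alpha> * complex_of_real (\<alpha> \<bullet> v)) *\<^sub>C divided_difference \<alpha> (linear_form w * f))
      = linear_form w * ?Q + (?R + ?R)"
  proof -
    have "(\<kappa> \<alpha> * complex_of_real (\<alpha> \<bullet> v)) *\<^sub>C divided_difference \<alpha> (linear_form w * f)
        = linear_form w * ((\<kappa> \<alpha> * complex_of_real (\<alpha> \<bullet> v)) *\<^sub>C divided_difference \<alpha> f)
          + (\<kappa> \<alpha> * complex_of_real ((\<alpha> \<bullet> v) * (\<alpha> \<bullet> w))) *\<^sub>C group_act (reflection \<alpha>) f
          + (\<kappa> \<alpha> * complex_of_real ((\<alpha> \<bullet> v) * (\<alpha> \<bullet> w))) *\<^sub>C group_act (reflection \<alpha>) f"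
      if "\<alpha> \<in> pos_roots m" for \<alpha>
      unfolding divided_difference_linear_form_mult[OF pos_roots_unit[OF that]]
      by (rule poly3_eqI) (simp only: peval_simps, simp add: algebra_simps)
    then show ?thesis
      by (simp add: refl_form_def sum.distrib sum_distrib_left add.assoc)
  qed
  ultimately show "op_apply (dunkl_dir m \<kappa> v * linear_op w - linear_op w * dunkl_dir m \<kappa> v) f
     = op_apply (complex_of_real (v \<bullet> w) *\<^sub>C 1 + (refl_form m \<kappa> v w + refl_form m \<kappa> v w)) f"
    by (simp add: op_apply_dunkl_dir distrib_left)
qed

lemma linear_op_commute: "linear_op v * linear_op w = linear_op w * linear_op v"
  by (rule poly_op_eqI) (simp add: mult.left_commute)

lemma inner_reflection_commute: "reflection \<beta> x \<bullet> y = x \<bullet> reflection \<beta> y"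
  by (simp add: reflection_def inner_diff_left inner_diff_right inner_commute)

lemma inner_reflection_reflection: "reflection \<beta> x \<bullet> reflection \<beta> y = x \<bullet> y"
  by (simp add: inner_reflection_commute)

lemma reflection_conjugate: "reflection \<beta> (reflection \<alpha> (reflection \<beta> x)) = reflection (reflection \<beta> \<alpha>) x"
proof -
  have "reflection \<beta> (reflection \<alpha> (reflection \<beta> x))
      = x - (2 * (reflection \<beta> x \<bullet> \<alpha>) / (\<alpha> \<bullet> \<alpha>)) *\<^sub>R reflection \<beta> \<alpha>"
    unfolding reflection_def[of \<alpha>]
    by (simp add: linear_diff[OF linear_reflection] linear_scale[OF linear_reflection])
  then show ?thesis
    by (simp add: reflection_def[of "reflection \<beta> \<alpha>"] inner_reflection_reflection inner_reflection_commute)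
qed

lemma group_op_reflection_square: "group_op (reflection \<beta>) * group_op (reflection \<beta>) = 1"
  by (intro poly_op_eqI poly3_eqI) simp

lemma group_op_reflection_conjugate:
  "group_op (reflection \<beta>) * group_op (reflection \<alpha>) * group_op (reflection \<beta>)
     = group_op (reflection (reflection \<beta> \<alpha>))"
  by (intro poly_op_eqI poly3_eqI) (simp add: reflection_conjugate)

lemma group_op_linear_op:
  "group_op (reflection \<beta>) * linear_op w = linear_op (reflection \<beta> w) * group_op (reflection \<beta>)"
  by (intro poly_op_eqI poly3_eqI) (simp add: linear_form.rep_eq inner_reflection_commute)


section \<open>Equivariance and commutativity of Dunkl operators\<close>

context
  fixes m :: nat and \<kappa> :: "real^3 \<Rightarrow> complex"
  assumes m: "m \<ge> 1"
    and inv: "\<And>w \<alpha>. w \<in> reflection_group m \<Longrightarrow> \<alpha> \<in> roots m \<Longrightarrow> \<kappa> (w \<alpha>) = \<kappa> \<alpha>"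
begin

lemma kappa_reflection:
  assumes "\<alpha> \<in> roots m" "\<beta> \<in> roots m"
  shows "\<kappa> (reflection \<beta> \<alpha>) = \<kappa> \<alpha>"
  using assms by (intro inv) (auto simp: reflection_group_def intro: generate.incl)

lemma kappa_uminus:
  assumes "\<alpha> \<in> roots m"
  shows "\<kappa> (- \<alpha>) = \<kappa> \<alpha>"
  using kappa_reflection[OF assms assms] roots_unit[OF assms]
  by (simp add: reflection_unit scaleR_2)

text \<open>
  Conjugation by \<open>\<sigma>\<^sub>\<beta>\<close> permutes the reflections in the sum. The factors \<open>\<kappa> \<alpha>\<close> are invariant, and in the
  inner products the action on \<open>\<alpha>\<close> moves to the arguments \<open>v\<close> and \<open>w\<close>.
\<close>
lemma refl_form_conjugate:
  assumes "\<beta> \<in> roots m"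
  shows "group_op (reflection \<beta>) * refl_form m \<kappa> v w * group_op (reflection \<beta>)
    = refl_form m \<kappa> (reflection \<beta> v) (reflection \<beta> w)"
proof -
  define F where "F \<alpha> = (\<kappa> \<alpha> * complex_of_real ((\<alpha> \<bullet> reflection \<beta> v) * (\<alpha> \<bullet> reflection \<beta> w)))
      *\<^sub>C group_op (reflection \<alpha>)" for \<alpha>
  have "reflection (- \<alpha>) = reflection \<alpha>" for \<alpha> by (simp add: reflection_def fun_eq_iff)
  then have "F (- \<alpha>) = F \<alpha>" if "\<alpha> \<in> roots m" for \<alpha>
    using that by (simp add: F_def kappa_uminus)
  from sum_pos_roots_reflection[of m \<beta> F, OF m assms this]
  have "refl_form m \<kappa> (reflection \<beta> v) (reflection \<beta> w) = (\<Sum>\<alpha>\<in>pos_roots m. F (reflection \<beta> \<alpha>))"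
    by (simp add: refl_form_def F_def)
  also have "\<dots> = (\<Sum>\<alpha>\<in>pos_roots m. (\<kappa> \<alpha> * complex_of_real ((\<alpha> \<bullet> v) * (\<alpha> \<bullet> w))) *\<^sub>C
      (group_op (reflection \<beta>) * group_op (reflection \<alpha>) * group_op (reflection \<beta>)))"
    using assms by (intro sum.cong)
      (simp_all add: F_def kappa_reflection roots_eq_pos_roots_Un[OF m] inner_reflection_reflection
        group_op_reflection_conjugate)
  finally show ?thesis
    by (simp add: refl_form_def sum_distrib_left sum_distrib_right mult_scaleC_left mult_scaleC_right)
qed

text \<open>
  Multiplied by the reflection from the right, both sides kill \<open>1\<close> and, by \<open>dunkl_dir_linear_op\<close> and
  \<open>refl_form_conjugate\<close>, have the same commutators with linear forms; so their difference is zero.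
\<close>
lemma dunkl_dir_equivariant:
  assumes "\<beta> \<in> roots m"
  shows "group_op (reflection \<beta>) * dunkl_dir m \<kappa> v
    = dunkl_dir m \<kappa> (reflection \<beta> v) * group_op (reflection \<beta>)"
proof -
  define s where "s = group_op (reflection \<beta>)"
  define T where "T = s * dunkl_dir m \<kappa> v * s - dunkl_dir m \<kappa> (reflection \<beta> v)"
  have ss: "s * s = 1" by (simp add: s_def group_op_reflection_square)
  have "T = 0"
  proof (rule poly_op_zero_if_commutes)
    fix w
    let ?D = "dunkl_dir m \<kappa> v" and ?X = "linear_op (reflection \<beta> w)"
    have sX: "s * linear_op w = ?X * s" "linear_op w * s = s * ?X"
      using group_op_linear_op[of \<beta> w] group_op_linear_op[of \<beta> "reflection \<beta> w"]
      by (simp_all add: s_def)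
    have "s * ?D * s * linear_op w - linear_op w * (s * ?D * s) = s * (?D * ?X - ?X * ?D) * s"
    proof -
      have "s * ?D * s * linear_op w = s * ?D * (s * linear_op w)" by (simp only: mult.assoc)
      moreover have "linear_op w * (s * ?D * s) = (linear_op w * s) * ?D * s" by (simp only: mult.assoc)
      ultimately show ?thesis unfolding sX by (simp add: algebra_simps)
    qed
    also have "\<dots> = complex_of_real (v \<bullet> reflection \<beta> w) *\<^sub>C (s * s)
        + (s * refl_form m \<kappa> v (reflection \<beta> w) * s + s * refl_form m \<kappa> v (reflection \<beta> w) * s)"
      unfolding dunkl_dir_linear_op by (simp add: algebra_simps mult_scaleC_left mult_scaleC_right)
    also have "\<dots> = dunkl_dir m \<kappa> (reflection \<beta> v) * linear_op w - linear_op w * dunkl_dir m \<kappa> (reflection \<beta> v)"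
      unfolding dunkl_dir_linear_op ss
      by (simp add: s_def refl_form_conjugate[OF assms] inner_reflection_commute)
    finally show "T * linear_op w = linear_op w * T"
      unfolding T_def by (simp add: left_diff_distrib right_diff_distrib) (simp add: algebra_simps)
  next
    have "group_act (reflection \<beta>) 1 = 1" by (rule poly3_eqI) simp
    then show "op_apply T 1 = 0"
      by (simp add: T_def s_def dunkl_dir_one flip: op_apply_simps(9))
  qed
  then have "s * dunkl_dir m \<kappa> v * (s * s) = dunkl_dir m \<kappa> (reflection \<beta> v) * s"
    unfolding T_def by (simp flip: mult.assoc)
  then show ?thesis unfolding ss by (simp add: s_def)
qed

text \<open>
  By equivariance, passing \<open>\<sigma>\<^sub>\<alpha>\<close> changes \<open>D\<^sub>v\<close> by a multiple of \<open>D\<^sub>\<alpha>\<close>. The point of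
  the formula is that its right-hand side is symmetric in \<open>v\<close>, \<open>u\<close> and \<open>w\<close>.
\<close>
lemma dunkl_dir_refl_form:
  "dunkl_dir m \<kappa> v * refl_form m \<kappa> u w - refl_form m \<kappa> u w * dunkl_dir m \<kappa> v
    = (\<Sum>\<alpha>\<in>pos_roots m. (2 * \<kappa> \<alpha> * complex_of_real ((\<alpha> \<bullet> v) * (\<alpha> \<bullet> u) * (\<alpha> \<bullet> w))) *\<^sub>C
        (dunkl_dir m \<kappa> \<alpha> * group_op (reflection \<alpha>)))"
proof -
  have "dunkl_dir m \<kappa> v * group_op (reflection \<alpha>) - group_op (reflection \<alpha>) * dunkl_dir m \<kappa> v
      = complex_of_real (2 * (\<alpha> \<bullet> v)) *\<^sub>C (dunkl_dir m \<kappa> \<alpha> * group_op (reflection \<alpha>))"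
    if "\<alpha> \<in> pos_roots m" for \<alpha>
  proof -
    have "\<alpha> \<in> roots m" using that by (simp add: roots_eq_pos_roots_Un[OF m])
    then show ?thesis
      by (simp add: dunkl_dir_equivariant reflection_unit[OF pos_roots_unit[OF that]] dunkl_dir_linear
          left_diff_distrib mult_scaleC_left inner_commute)
  qed
  then show ?thesis
    unfolding refl_form_def sum_distrib_left sum_distrib_right mult_scaleC_left mult_scaleC_right
      sum_subtractf[symmetric] scaleC_diff_right[symmetric]
    by (intro sum.cong) (simp_all add: scaleC_scaleC mult_ac)
qed

text \<open>
  Dunkl's theorem. By the Jacobi identity, the commutator of two Dunkl operators has with a linear
  form the commutator \<open>[D\<^sub>v, [D\<^sub>u, x\<^sub>w]] - [D\<^sub>u, [D\<^sub>v, x\<^sub>w]]\<close>, which vanishes by the symmetry in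
  \<open>dunkl_dir_refl_form\<close>. It also kills \<open>1\<close>, hence it is zero.
\<close>
lemma dunkl_dir_commute: "dunkl_dir m \<kappa> v * dunkl_dir m \<kappa> u = dunkl_dir m \<kappa> u * dunkl_dir m \<kappa> v"
proof -
  let ?D = "dunkl_dir m \<kappa>"
  define T where "T = ?D v * ?D u - ?D u * ?D v"
  have "T = 0"
  proof (rule poly_op_zero_if_commutes)
    fix w
    let ?X = "linear_op w" and ?M = "\<lambda>v. refl_form m \<kappa> v w"
    have "T * ?X - ?X * T
        = (?D v * (?D u * ?X - ?X * ?D u) - (?D u * ?X - ?X * ?D u) * ?D v)
          - (?D u * (?D v * ?X - ?X * ?D v) - (?D v * ?X - ?X * ?D v) * ?D u)"
      unfolding T_def by (simp only: left_diff_distrib right_diff_distrib mult.assoc) simp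
    also have "\<dots> = (?D v * ?M u - ?M u * ?D v + (?D v * ?M u - ?M u * ?D v))
        - (?D u * ?M v - ?M v * ?D u + (?D u * ?M v - ?M v * ?D u))"
    proof -
      have "a * (c *\<^sub>C 1 + (b + b)) - (c *\<^sub>C 1 + (b + b)) * a = a * b - b * a + (a * b - b * a)"
        for a b :: poly_op and c
        by (simp add: distrib_left distrib_right mult_scaleC_left mult_scaleC_right)
      then show ?thesis unfolding dunkl_dir_linear_op by simp
    qed
    also have "\<dots> = 0"
      unfolding dunkl_dir_refl_form[of v u w] dunkl_dir_refl_form[of u v w]
      by (simp add: mult.commute[of "\<alpha> \<bullet> v" "\<alpha> \<bullet> u" for \<alpha>])
    finally show "T * ?X = ?X * T" by simp
  qed (simp add: T_def dunkl_dir_one)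
  then show ?thesis by (simp add: T_def)
qed

end


section \<open>Angular momentum operators\<close>

lemma double_cancel: "x = y" if "x + x = y + y" for x y :: "'a::complex_vector"
  using arg_cong[OF that, of "scaleC (1/2)"]
  by (simp add: scaleC_add_right scaleC_one flip: scaleC_add_left)

lemma scaleC_minus_left: "(- c) *\<^sub>C x = - (c *\<^sub>C (x::'a::complex_vector))"
  by (rule module.scale_minus_left[OF module_scaleC])

text \<open>
  As the \<open>x\<close> commute, the \<open>D\<close> commute and \<open>M\<close> is symmetric, the Jacobi identity makes the
  commutators \<open>Y\<close> and \<open>Z\<close> of \<open>M\<close> with \<open>x\<close> and \<open>D\<close> totally symmetric in their three indices.
  When the anticommutators on the right are brought to the form \<open>x M D\<close>, these commutators appear
  antisymmetrised and cancel; what remains is the commutator on the left.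
\<close>
lemma angular_momentum_commutator:
  fixes x D :: "'i \<Rightarrow> 'a::complex_algebra_1" and M :: "'i \<Rightarrow> 'i \<Rightarrow> 'a"
  assumes xx: "\<And>a b. x a * x b = x b * x a" and DD: "\<And>a b. D a * D b = D b * D a"
    and Dx: "\<And>a b. D a * x b - x b * D a = (if a = b then 1 else 0) + (M a b + M a b)"
    and M_sym: "\<And>a b. M a b = M b a"
    and L: "\<And>a b. L a b = x a * D b - x b * D a"
    and distinct: "i \<noteq> j" "j \<noteq> k" "k \<noteq> i"
  shows "L j k * L k i - L k i * L j k = - L i j - (L j k * M i k + M i k * L j k
    + (L k i * M j k + M j k * L k i) + (L i j * M k k + M k k * L i j))"
proof -
  define Y where "Y a b c = M a b * x c - x c * M a b" for a b c
  define Z where "Z a b c = D a * M b c - M b c * D a" for a b c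
  define C where "C a b = (if a = b then 1 else 0) + (M a b + M a b)" for a b
  have jacobi: "(p * q - q * p) * r - r * (p * q - q * p)
      = (p * r - r * p) * q - q * (p * r - r * p)" if "q * r = r * q" for p q r :: 'a
  proof -
    have "p * (q * r) = p * (r * q)" "q * (r * p) = r * (q * p)"
      by (simp_all add: that flip: mult.assoc)
    then show ?thesis by (simp add: algebra_simps)
  qed
  have com_delta: "((if P then 1 else 0) + (a + a)) * b - b * ((if P then 1 else 0) + (a + a))
      = (a * b - b * a) + (a * b - b * a)" for P and a b :: 'a
    by (simp add: distrib_left distrib_right)
  have Y: "Y a b c = Y a c b" for a b c
  proof (rule double_cancel)
    show "Y a b c + Y a b c = Y a c b + Y a c b"
      using jacobi[OF xx, of "D a" b c] unfolding Dx com_delta Y_def .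
  qed
  have Y_sym: "Y a b c = Y b a c" for a b c by (simp add: Y_def M_sym[of a b])
  have Y_eqs: "Y i k j = Y j k i" "Y i k k = Y k k i" "Y j k k = Y k k j"
    using Y Y_sym by metis+
  have Z: "Z a b c = Z b a c" for a b c
  proof (rule double_cancel)
    have "(D a * x c - x c * D a) * D b - D b * (D a * x c - x c * D a)
      = (D b * x c - x c * D b) * D a - D a * (D b * x c - x c * D b)"
    proof -
      have "D a * (D b * x c) = D b * (D a * x c)" "x c * (D a * D b) = x c * (D b * D a)"
        by (simp_all add: DD[of a b] flip: mult.assoc)
      then show ?thesis by (simp add: algebra_simps)
    qed
    then show "Z a b c + Z a b c = Z b a c + Z b a c"
      unfolding Dx com_delta Z_def by (simp add: algebra_simps)
  qed
  have anti: "(x a * D b - x b * D a) * M c d + M c d * (x a * D b - x b * D a)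
      = (x a * M c d * D b + x a * M c d * D b - (x b * M c d * D a + x b * M c d * D a))
        + (x a * Z b c d - x b * Z a c d) + (Y c d a * D b - Y c d b * D a)" for a b c d
    unfolding Y_def Z_def by (simp add: algebra_simps)
  have com: "(x a * D b) * (x c * D d) - (x c * D d) * (x a * D b)
      = x a * C b c * D d - x c * C d a * D b" for a b c d
  proof -
    have "D b * x c = x c * D b + C b c" "D d * x a = x a * D d + C d a"
      using Dx[of b c] Dx[of d a] by (simp_all add: C_def algebra_simps)
    then have "x a * (D b * x c) * D d = x a * x c * (D b * D d) + x a * C b c * D d"
      "x c * (D d * x a) * D b = x c * x a * (D d * D b) + x c * C d a * D b"
      by (simp_all add: algebra_simps)
    then show ?thesis using xx[of a c] DD[of b d] by (simp add: mult.assoc)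
  qed
  have "L j k * L k i - L k i * L j k
      = ((x j * D k) * (x k * D i) - (x k * D i) * (x j * D k))
        - ((x j * D k) * (x i * D k) - (x i * D k) * (x j * D k))
        - ((x k * D j) * (x k * D i) - (x k * D i) * (x k * D j))
        + ((x k * D j) * (x i * D k) - (x i * D k) * (x k * D j))"
    unfolding L by (simp only: left_diff_distrib right_diff_distrib) simp
  also have "\<dots> = x j * C k k * D i - x i * C k k * D j - x j * C k i * D k + x i * C k j * D k
      - x k * C j k * D i + x k * C i k * D j"
    using distinct unfolding com by (simp add: C_def M_sym[of i j])
  also have "\<dots> = - L i j - (L j k * M i k + M i k * L j k
    + (L k i * M j k + M j k * L k i) + (L i j * M k k + M k k * L i j))"
    using distinct
    unfolding L anti Y_eqs Z[of k i k] Z[of k j k] Z[of j i k]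
    by (simp add: C_def distrib_left distrib_right M_sym[of k i] M_sym[of k j] M_sym[of j i])
  finally show ?thesis .
qed


section \<open>The even subalgebra of the Clifford algebra\<close>

lemma embed_linear:
  "embed (a + b) = embed a + embed b" "embed (a - b) = embed a - embed b" "embed (- a) = - embed a"
  "embed (c *\<^sub>C a) = c *\<^sub>C embed a" "embed 0 = 0"
  for a b :: "'a::complex_vector"
  by (auto intro!: clifford_eqI simp: embed_def blade.rep_eq)

lemma cmult_minus: "(- X) \<star>[\<epsilon>] Y = - (X \<star>[\<epsilon>] Y)" "X \<star>[\<epsilon>] (- Y) = - (X \<star>[\<epsilon>] Y)"
  using cmult_scaleC(1)[of \<epsilon> "-1" X Y] cmult_scaleC(2)[of \<epsilon> X "-1" Y]
  by (simp_all add: scaleC_minus_left scaleC_one)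

lemma cmult_diff:
  "(X - Y) \<star>[\<epsilon>] Z = X \<star>[\<epsilon>] Z - Y \<star>[\<epsilon>] Z" "Z \<star>[\<epsilon>] (X - Y) = Z \<star>[\<epsilon>] X - Z \<star>[\<epsilon>] Y"
  using cmult_distrib(1)[of \<epsilon> X "- Y" Z] cmult_distrib(2)[of \<epsilon> Z X "- Y"]
  by (simp_all add: cmult_minus)

lemma cmult_zero: "0 \<star>[\<epsilon>] X = 0"
  using cmult_scaleC(1)[of \<epsilon> 0 X X] by simp

lemma gen_square: "gen j \<star>[\<epsilon>] gen j = \<epsilon> *\<^sub>C 1"
proof (rule double_cancel)
  show "gen j \<star>[\<epsilon>] gen j + gen j \<star>[\<epsilon>] gen j = \<epsilon> *\<^sub>C 1 + \<epsilon> *\<^sub>C (1 :: 'a::complex_algebra_1 clifford)"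
    using clifford_relation[of \<epsilon> j j] by (simp only: mult_2[of \<epsilon>] simp_thms if_True scaleC_add_left)
qed

lemma gen_anticommute: "j \<noteq> k \<Longrightarrow> gen j \<star>[\<epsilon>] gen k = - (gen k \<star>[\<epsilon>] gen j)"
  using clifford_relation[of \<epsilon> j k] by (simp add: eq_neg_iff_add_eq_0)

lemma gen_left_square: "gen j \<star>[\<epsilon>] (gen j \<star>[\<epsilon>] X) = \<epsilon> *\<^sub>C X"
  by (simp add: gen_square cmult_scaleC cmult_one flip: cmult_assoc)

lemma gen_left_anticommute: "j \<noteq> k \<Longrightarrow> gen j \<star>[\<epsilon>] (gen k \<star>[\<epsilon>] X) = - (gen k \<star>[\<epsilon>] (gen j \<star>[\<epsilon>] X))"
  by (simp add: gen_anticommute[of j k] cmult_minus flip: cmult_assoc)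

lemma gen_left_embed: "gen j \<star>[\<epsilon>] (embed a \<star>[\<epsilon>] X) = embed a \<star>[\<epsilon>] (gen j \<star>[\<epsilon>] X)"
  by (simp add: embed_cmult_gen flip: cmult_assoc)

lemma embed_left_cmult: "embed a \<star>[\<epsilon>] (embed b \<star>[\<epsilon>] X) = embed (a * b) \<star>[\<epsilon>] X"
  by (simp add: embed_cmult flip: cmult_assoc)

lemma three_distinct: "(2::3) \<noteq> 1" "(3::3) \<noteq> 2" "(3::3) \<noteq> 1"
  by simp_all

lemmas word_order =
  gen_anticommute[OF three_distinct(1)] gen_anticommute[OF three_distinct(2)] gen_anticommute[OF three_distinct(3)]
  gen_left_anticommute[OF three_distinct(1)] gen_left_anticommute[OF three_distinct(2)] gen_left_anticommute[OF three_distinct(3)]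

text \<open>
  These rules rewrite a product to a coefficient followed by an increasing word in the generators.
\<close>
lemmas clifford_normalize =
  cmult_assoc cmult_distrib cmult_diff cmult_minus cmult_scaleC cmult_one
  gen_square gen_left_square embed_cmult embed_left_cmult gen_left_embed embed_cmult_gen[symmetric]
  word_order scaleC_add_right scaleC_diff_right scaleC_minus_right scaleC_scaleC

text \<open>
  The elements of the even subalgebra, which is a quaternion algebra with operator coefficients.
\<close>
definition quat :: "complex \<Rightarrow> 'a \<Rightarrow> 'a \<Rightarrow> 'a \<Rightarrow> 'a \<Rightarrow> 'a::complex_algebra_1 clifford" where
  "quat \<epsilon> a b c d = embed a + embed b \<star>[\<epsilon>] (gen 2 \<star>[\<epsilon>] gen 3)
     + embed c \<star>[\<epsilon>] (gen 3 \<star>[\<epsilon>] gen 1) + embed d \<star>[\<epsilon>] (gen 1 \<star>[\<epsilon>] gen 2)"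

text \<open>
  For \<open>\<epsilon> = 1\<close> and \<open>\<epsilon> = - 1\<close> this element is central with square \<open>- \<epsilon>\<close>. Multiplication by it therefore
  exchanges the odd and the even elements and changes squares only by the factor \<open>- \<epsilon>\<close>.
\<close>
definition pseudoscalar :: "complex \<Rightarrow> 'a::complex_algebra_1 clifford" where
  "pseudoscalar \<epsilon> = gen 1 \<star>[\<epsilon>] (gen 2 \<star>[\<epsilon>] gen 3)"

lemma quat_linear:
  "quat \<epsilon> a b c d + quat \<epsilon> a' b' c' d' = quat \<epsilon> (a + a') (b + b') (c + c') (d + d')"
  "z *\<^sub>C quat \<epsilon> a b c d = quat \<epsilon> (z *\<^sub>C a) (z *\<^sub>C b) (z *\<^sub>C c) (z *\<^sub>C d)"
  by (simp_all add: quat_def embed_linear cmult_distrib cmult_scaleC scaleC_add_right)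

lemma quat_one: "1 = quat \<epsilon> 1 0 0 0"
  by (simp add: quat_def one_clifford_def embed_linear cmult_zero)

context
  fixes \<epsilon> :: complex
  assumes \<epsilon>: "\<epsilon> * \<epsilon> = 1"
begin

lemma quat_cmult:
  "quat \<epsilon> a b c d \<star>[\<epsilon>] quat \<epsilon> a' b' c' d' = quat \<epsilon>
    (a * a' - b * b' - c * c' - d * d')
    (a * b' + b * a' - \<epsilon> *\<^sub>C (c * d' - d * c'))
    (a * c' + c * a' - \<epsilon> *\<^sub>C (d * b' - b * d'))
    (a * d' + d * a' - \<epsilon> *\<^sub>C (b * c' - c * b'))"
  by (simp add: quat_def clifford_normalize embed_linear \<epsilon> scaleC_one mult.left_commute
      one_clifford_def)

lemma pseudoscalar_square: "pseudoscalar \<epsilon> \<star>[\<epsilon>] pseudoscalar \<epsilon> = - (\<epsilon> *\<^sub>C (1 :: 'a::complex_algebra_1 clifford))"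
  by (simp add: pseudoscalar_def clifford_normalize \<epsilon> scaleC_one)

lemma pseudoscalar_central: "pseudoscalar \<epsilon> \<star>[\<epsilon>] quat \<epsilon> a b c d = quat \<epsilon> a b c d \<star>[\<epsilon>] pseudoscalar \<epsilon>"
  by (simp add: pseudoscalar_def quat_def clifford_normalize \<epsilon> scaleC_one)

lemma csquare_quat_pseudoscalar:
  "csquare \<epsilon> (quat \<epsilon> a b c d \<star>[\<epsilon>] pseudoscalar \<epsilon>) = (- \<epsilon>) *\<^sub>C csquare \<epsilon> (quat \<epsilon> a b c d)"
proof -
  let ?q = "quat \<epsilon> a b c d" and ?w = "pseudoscalar \<epsilon> :: 'a clifford"
  have "csquare \<epsilon> (?q \<star>[\<epsilon>] ?w) = ?q \<star>[\<epsilon>] (?w \<star>[\<epsilon>] ?q) \<star>[\<epsilon>] ?w"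
    by (simp add: cmult_assoc)
  also have "\<dots> = csquare \<epsilon> ?q \<star>[\<epsilon>] (?w \<star>[\<epsilon>] ?w)"
    unfolding pseudoscalar_central by (simp add: cmult_assoc)
  finally show ?thesis
    by (simp add: pseudoscalar_square cmult_minus cmult_scaleC cmult_one scaleC_minus_left)
qed

lemma vector_eq_quat_pseudoscalar:
  "embed a \<star>[\<epsilon>] gen 1 + embed b \<star>[\<epsilon>] gen 2 + embed c \<star>[\<epsilon>] gen 3
    = quat \<epsilon> 0 (- a) (- b) (- c) \<star>[\<epsilon>] pseudoscalar \<epsilon>"
  by (simp add: pseudoscalar_def quat_def clifford_normalize \<epsilon> scaleC_one embed_linear)

end


section \<open>The identity in the even subalgebra\<close>

lemma half_half: "(1/2) *\<^sub>C x + (1/2) *\<^sub>C x = (x::'a::complex_vector)"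
  by (simp add: scaleC_one flip: scaleC_add_left)

text \<open>
  The squares of the three kinds of symmetries, written in the even subalgebra. The scalar
  components agree by expansion. In a bivector component all products of entries of the matrix
  \<open>m\<close> cancel, and the assumed commutator is exactly what is left. The \<open>l1\<close>, \<open>l2\<close>, \<open>l3\<close> stand for the
  angular momenta \<open>L\<^sub>2\<^sub>3\<close>, \<open>L\<^sub>3\<^sub>1\<close>, \<open>L\<^sub>1\<^sub>2\<close> and \<open>m\<close> for the entries of \<open>refl_form\<close>.
\<close>
lemma even_square_identity:
  fixes h l1 l2 l3 m11 m12 m13 m21 m22 m23 m31 m32 m33 :: "'a::complex_algebra_1"
  assumes \<epsilon>: "\<epsilon> \<in> {-1, 1}"
    and sym: "m21 = m12" "m31 = m13" "m32 = m23"
    and h: "h = (1/2) *\<^sub>C 1"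
    and c1: "l2 * l3 - l3 * l2 = - l1 - ((l1 * m11 + m11 * l1) + (l2 * m21 + m21 * l2) + (l3 * m31 + m31 * l3))"
    and c2: "l3 * l1 - l1 * l3 = - l2 - ((l1 * m12 + m12 * l1) + (l2 * m22 + m22 * l2) + (l3 * m32 + m32 * l3))"
    and c3: "l1 * l2 - l2 * l1 = - l3 - ((l1 * m13 + m13 * l1) + (l2 * m23 + m23 * l2) + (l3 * m33 + m33 * l3))"
  shows "(- \<epsilon>) *\<^sub>C csquare \<epsilon> (quat \<epsilon> (\<epsilon> *\<^sub>C (1 + m11 + m22 + m33)) (- l1) (- l2) (- l3)) =
    - (\<epsilon> / 4) *\<^sub>C 1
    + (- \<epsilon>) *\<^sub>C csquare \<epsilon> (quat \<epsilon> 0 (- (\<epsilon> *\<^sub>C m11)) (- (\<epsilon> *\<^sub>C m12)) (- (\<epsilon> *\<^sub>C m13)))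
    + (- \<epsilon>) *\<^sub>C csquare \<epsilon> (quat \<epsilon> 0 (- (\<epsilon> *\<^sub>C m21)) (- (\<epsilon> *\<^sub>C m22)) (- (\<epsilon> *\<^sub>C m23)))
    + (- \<epsilon>) *\<^sub>C csquare \<epsilon> (quat \<epsilon> 0 (- (\<epsilon> *\<^sub>C m31)) (- (\<epsilon> *\<^sub>C m32)) (- (\<epsilon> *\<^sub>C m33)))
    + \<epsilon> *\<^sub>C (csquare \<epsilon> (quat \<epsilon> l3 (- (\<epsilon> *\<^sub>C m31)) (- (\<epsilon> *\<^sub>C m32)) (\<epsilon> *\<^sub>C (h + m11 + m22)))
        + csquare \<epsilon> (quat \<epsilon> l2 (- (\<epsilon> *\<^sub>C m21)) (\<epsilon> *\<^sub>C (h + m33 + m11)) (- (\<epsilon> *\<^sub>C m23)))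
        + csquare \<epsilon> (quat \<epsilon> l1 (\<epsilon> *\<^sub>C (h + m22 + m33)) (- (\<epsilon> *\<^sub>C m12)) (- (\<epsilon> *\<^sub>C m13))))"
proof -
  have \<epsilon>\<epsilon>: "\<epsilon> * \<epsilon> = 1" using \<epsilon> by auto
  have h_central: "h * x = x * h" for x by (simp add: h mult_scaleC_left mult_scaleC_right)
  \<comment> \<open>For arbitrary \<open>x\<close> this would rewrite \<open>h * h\<close> to itself forever, so it is instantiated.\<close>
  note h_right = h_central[of m11] h_central[of m12] h_central[of m13] h_central[of m22]
    h_central[of m23] h_central[of m33] h_central[of l1] h_central[of l2] h_central[of l3]
  have halves: "h + h = 1" "x * h + x * h = x" "x * h + (x * h + y) = x + y" for x y
    using half_half[of x] half_half[of "1 :: 'a"] by (simp_all add: h mult_scaleC_right flip: add.assoc)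
  have h_square: "(1/4) *\<^sub>C 1 = h * h" by (simp add: h mult_scaleC_left scaleC_scaleC)
  have "(\<epsilon>/4) *\<^sub>C 1 = \<epsilon> *\<^sub>C (h * h)" by (simp add: scaleC_scaleC flip: h_square)
  then have quarter: "- (\<epsilon> / 4) *\<^sub>C 1 = quat \<epsilon> (- (\<epsilon> *\<^sub>C (h * h))) 0 0 0"
    by (simp add: quat_one[of \<epsilon>] quat_linear scaleC_minus_left)
  have quat_eqI: "quat \<epsilon> a b c d = quat \<epsilon> a' b' c' d'" if "a = a'" "b = b'" "c = c'" "d = d'"
    for a b c d a' b' c' d' :: 'a using that by simp
  \<comment> \<open>Solved for one of the two products, the commutators become rewrite rules.\<close>
  note swap = c1[unfolded diff_eq_eq sym] c2[unfolded diff_eq_eq sym] c3[unfolded diff_eq_eq sym]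
  note expand = sym scaleC_minus_left scaleC_one algebra_simps h_right halves
  show ?thesis
    using \<epsilon> unfolding quat_cmult[OF \<epsilon>\<epsilon>] quarter quat_linear
  proof (intro quat_eqI, goal_cases)
    case 1
    then show ?case by (elim insertE emptyE) (simp_all add: expand)
  next
    case 2
    then show ?case by (elim insertE emptyE) (simp_all add: expand swap(1))
  next
    case 3
    then show ?case by (elim insertE emptyE) (simp_all add: expand swap(2))
  next
    case 4
    then show ?case by (elim insertE emptyE) (simp_all add: expand swap(3))
  qed
qed


section \<open>The symmetries in the even subalgebra\<close>

lemma cmult_sum_left: "(\<Sum>i\<in>I. X i) \<star>[\<epsilon>] Y = (\<Sum>i\<in>I. X i \<star>[\<epsilon>] Y)"
  by (induction I rule: infinite_finite_induct) (simp_all add: cmult_zero cmult_distrib)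

lemma embed_sum: "embed (\<Sum>i\<in>I. a i) = (\<Sum>i\<in>I. embed (a i :: 'a::complex_vector))"
  by (induction I rule: infinite_finite_induct) (simp_all add: embed_linear)

abbreviation refl_entry :: "nat \<Rightarrow> (real^3 \<Rightarrow> complex) \<Rightarrow> 3 \<Rightarrow> 3 \<Rightarrow> poly_op" where
  "refl_entry m \<kappa> i j \<equiv> refl_form m \<kappa> (axis i 1) (axis j 1)"

lemma sym1_vector:
  assumes "m \<ge> 1"
  shows "sym1 m \<kappa> \<epsilon> j = \<epsilon> *\<^sub>C (embed (refl_entry m \<kappa> j 1) \<star>[\<epsilon>] gen 1
    + embed (refl_entry m \<kappa> j 2) \<star>[\<epsilon>] gen 2 + embed (refl_entry m \<kappa> j 3) \<star>[\<epsilon>] gen 3)"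
proof -
  have "(\<Sum>k=0..m. (\<kappa> (root_vec m k) * complex_of_real (root_vec m k $ j)) *\<^sub>C reflection_lift \<epsilon> (root_vec m k))
      = (\<Sum>\<alpha>\<in>pos_roots m. (\<kappa> \<alpha> * complex_of_real (\<alpha> $ j)) *\<^sub>C reflection_lift \<epsilon> \<alpha>)"
    unfolding pos_roots_def by (simp add: sum.reindex[OF inj_on_root_vec[OF assms]])
  moreover have "embed (refl_entry m \<kappa> j l) \<star>[\<epsilon>] gen l =
      (\<Sum>\<alpha>\<in>pos_roots m. (\<kappa> \<alpha> * complex_of_real (\<alpha> $ j)) *\<^sub>C complex_of_real (\<alpha> $ l) *\<^sub>C
        (embed (group_op (reflection \<alpha>)) \<star>[\<epsilon>] gen l))" for l
    by (simp add: refl_form_def embed_sum cmult_sum_left embed_linear cmult_scaleC inner_axis scaleC_scaleC mult.assoc)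
  ultimately show ?thesis
    by (simp add: sym1_def reflection_lift_def sum_3 cmult_distrib cmult_scaleC scaleC_add_right sum.distrib)
qed

context
  fixes m :: nat and \<kappa> :: "real^3 \<Rightarrow> complex" and \<epsilon> :: complex
  assumes m1: "m \<ge> 1" and \<epsilon>\<epsilon>: "\<epsilon> * \<epsilon> = 1"
begin

text \<open>
  Vectors are odd: \<open>vector_eq_quat_pseudoscalar\<close> writes the one-index symmetries as even
  elements times the pseudoscalar.
\<close>
lemma sym1_quat:
  "sym1 m \<kappa> \<epsilon> j = quat \<epsilon> 0 (- (\<epsilon> *\<^sub>C refl_entry m \<kappa> j 1)) (- (\<epsilon> *\<^sub>C refl_entry m \<kappa> j 2))
     (- (\<epsilon> *\<^sub>C refl_entry m \<kappa> j 3)) \<star>[\<epsilon>] pseudoscalar \<epsilon>"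
  unfolding sym1_vector[OF m1] vector_eq_quat_pseudoscalar[OF \<epsilon>\<epsilon>]
  by (simp add: quat_linear scaleC_minus_right flip: cmult_scaleC(1))

text \<open>
  In the two-index symmetry the contributions of \<open>O\<^sub>i e\<^sub>j - O\<^sub>j e\<^sub>i\<close> to the scalar component cancel
  since \<open>refl_form\<close> is symmetric.
\<close>
lemma sym2_quat:
  fixes h :: poly_op
  defines "h \<equiv> (1/2) *\<^sub>C 1"
  shows "sym2 m \<kappa> \<epsilon> 1 2 = quat \<epsilon> (ang_mom m \<kappa> 1 2)
      (- (\<epsilon> *\<^sub>C refl_entry m \<kappa> 3 1)) (- (\<epsilon> *\<^sub>C refl_entry m \<kappa> 3 2))
      (\<epsilon> *\<^sub>C (h + refl_entry m \<kappa> 1 1 + refl_entry m \<kappa> 2 2))" (is ?A)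
    and "sym2 m \<kappa> \<epsilon> 3 1 = quat \<epsilon> (ang_mom m \<kappa> 3 1)
      (- (\<epsilon> *\<^sub>C refl_entry m \<kappa> 2 1)) (\<epsilon> *\<^sub>C (h + refl_entry m \<kappa> 3 3 + refl_entry m \<kappa> 1 1))
      (- (\<epsilon> *\<^sub>C refl_entry m \<kappa> 2 3))" (is ?B)
    and "sym2 m \<kappa> \<epsilon> 2 3 = quat \<epsilon> (ang_mom m \<kappa> 2 3)
      (\<epsilon> *\<^sub>C (h + refl_entry m \<kappa> 2 2 + refl_entry m \<kappa> 3 3)) (- (\<epsilon> *\<^sub>C refl_entry m \<kappa> 1 2))
      (- (\<epsilon> *\<^sub>C refl_entry m \<kappa> 1 3))" (is ?C)
proof -
  note sym = refl_form_commute[of m \<kappa> "axis 2 1" "axis 1 1"] refl_form_commute[of m \<kappa> "axis 3 1" "axis 1 1"]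
    refl_form_commute[of m \<kappa> "axis 3 1" "axis 2 1"]
  have h: "embed h = (1/2) *\<^sub>C 1" by (simp add: h_def embed_linear one_clifford_def)
  note norm = sym2_def sym1_vector[OF m1] quat_def sym clifford_normalize embed_linear \<epsilon>\<epsilon> scaleC_one h
  show ?A by (simp add: norm)
  show ?B by (simp add: norm)
  show ?C by (simp add: norm)
qed

text \<open>
  The \<open>\<epsilon>/2\<close> terms add up to \<open>(-1 + 3) \<epsilon>/2 = \<epsilon>\<close>, and each \<open>O\<^sub>i\<close> survives once, which produces the
  trace of \<open>refl_form\<close> in the scalar component.
\<close>
lemma sym3_quat:
  "sym3 m \<kappa> \<epsilon> = quat \<epsilon> (\<epsilon> *\<^sub>C (1 + refl_entry m \<kappa> 1 1 + refl_entry m \<kappa> 2 2 + refl_entry m \<kappa> 3 3))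
     (- ang_mom m \<kappa> 2 3) (- ang_mom m \<kappa> 3 1) (- ang_mom m \<kappa> 1 2) \<star>[\<epsilon>] pseudoscalar \<epsilon>"
proof -
  note sym = refl_form_commute[of m \<kappa> "axis 2 1" "axis 1 1"] refl_form_commute[of m \<kappa> "axis 3 1" "axis 1 1"]
    refl_form_commute[of m \<kappa> "axis 3 1" "axis 2 1"]
  have one: "embed 1 = 1" by (simp add: one_clifford_def)
  show ?thesis
    by (simp add: sym3_def sym2_def sym1_vector[OF m1] quat_def pseudoscalar_def sym clifford_normalize
        embed_linear \<epsilon>\<epsilon> scaleC_one one)
      (simp flip: scaleC_add_left)
qed

end

theorem proposition2:
  fixes m :: nat and \<epsilon> :: complex and \<kappa> :: "real^3 \<Rightarrow> complex"
  assumes "m \<ge> 1"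
    and "\<epsilon> \<in> {-1, 1}"
    and "\<And>w \<alpha>. w \<in> reflection_group m \<Longrightarrow> \<alpha> \<in> roots m \<Longrightarrow> \<kappa> (w \<alpha>) = \<kappa> \<alpha>"
  shows "csquare \<epsilon> (sym3 m \<kappa> \<epsilon>) =
    - (\<epsilon> / 4) *\<^sub>C 1
    + csquare \<epsilon> (sym1 m \<kappa> \<epsilon> 1) + csquare \<epsilon> (sym1 m \<kappa> \<epsilon> 2) + csquare \<epsilon> (sym1 m \<kappa> \<epsilon> 3)
    + \<epsilon> *\<^sub>C (csquare \<epsilon> (sym2 m \<kappa> \<epsilon> 1 2) + csquare \<epsilon> (sym2 m \<kappa> \<epsilon> 3 1)
        + csquare \<epsilon> (sym2 m \<kappa> \<epsilon> 2 3))"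
proof -
  let ?M = "refl_entry m \<kappa>" and ?L = "ang_mom m \<kappa>"
  have \<epsilon>\<epsilon>: "\<epsilon> * \<epsilon> = 1" using assms(2) by auto
  have DD: "dunkl_op m \<kappa> a * dunkl_op m \<kappa> b = dunkl_op m \<kappa> b * dunkl_op m \<kappa> a" for a b
    unfolding dunkl_op_eq by (rule dunkl_dir_commute[OF assms(1,3)])
  have xx: "coord_op a * coord_op b = coord_op b * coord_op a" for a b
    unfolding coord_op_eq by (rule linear_op_commute)
  have Dx: "dunkl_op m \<kappa> a * coord_op b - coord_op b * dunkl_op m \<kappa> a
      = (if a = b then 1 else 0) + (?M a b + ?M a b)" for a b
    unfolding dunkl_op_eq coord_op_eq dunkl_dir_linear_op
    by (simp add: inner_axis_axis scaleC_one)
  note comm = angular_momentum_commutator[OF xx DD Dx refl_form_commute ang_mom_def]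
  show ?thesis
    unfolding sym1_quat[OF assms(1) \<epsilon>\<epsilon>] sym2_quat[OF assms(1) \<epsilon>\<epsilon>] sym3_quat[OF assms(1) \<epsilon>\<epsilon>]
      csquare_quat_pseudoscalar[OF \<epsilon>\<epsilon>]
  proof (rule even_square_identity[OF assms(2) _ _ _ refl])
    show "?L 3 1 * ?L 1 2 - ?L 1 2 * ?L 3 1 = - ?L 2 3 - (?L 2 3 * ?M 1 1 + ?M 1 1 * ?L 2 3
        + (?L 3 1 * ?M 2 1 + ?M 2 1 * ?L 3 1) + (?L 1 2 * ?M 3 1 + ?M 3 1 * ?L 1 2))"
      using comm[of 2 3 1] by (simp add: add_ac)
    show "?L 1 2 * ?L 2 3 - ?L 2 3 * ?L 1 2 = - ?L 3 1 - (?L 2 3 * ?M 1 2 + ?M 1 2 * ?L 2 3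
        + (?L 3 1 * ?M 2 2 + ?M 2 2 * ?L 3 1) + (?L 1 2 * ?M 3 2 + ?M 3 2 * ?L 1 2))"
      using comm[of 3 1 2] by (simp add: add_ac)
    show "?L 2 3 * ?L 3 1 - ?L 3 1 * ?L 2 3 = - ?L 1 2 - (?L 2 3 * ?M 1 3 + ?M 1 3 * ?L 2 3
        + (?L 3 1 * ?M 2 3 + ?M 2 3 * ?L 3 1) + (?L 1 2 * ?M 3 3 + ?M 3 3 * ?L 1 2))"
      using comm[of 1 2 3] by (simp add: add_ac)
  qed (rule refl_form_commute)+
qed

end
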